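(* Let $K$ be a field, let $P=K[x_1,\dots,x_n]$, let $X=(x_1,\dots,x_n)$, let $\mathfrak{M}=\langle x_1,\dots,x_n\rangle$, and let $I$ be an ideal of $P$ with $I\subseteq \mathfrak{M}$. Suppose that $I$ is $Z$-separating for some tuple $Z=(z_1,\dots,z_s)$ of pairwise distinct indeterminates in $X$ (with $1\le s\le n$), let $\sigma$ be a $Z$-separating term ordering for $I$, and let $Y=X\setminus Z$. Let $S_\sigma$ be the minimal set of indeterminates generating $\mathrm{LT}_\sigma(\langle \mathrm{Lin}_{\mathfrak{M}}(I)\rangle)$. Assume that $s=\dim_K(\mathrm{Lin}_{\mathfrak{M}}(I))$. Then the following claims hold. (a) The $Z$-separating re-embedding $\Phi: P/I\longrightarrow K[Y]/(I\cap K[Y])$ is an optimal re-embedding of $I$. (b) We have $\langle Z\rangle=\mathrm{LT}_\sigma(\langle\mathrm{Lin}_{\mathfrak{M}}(I)\rangle)$, and hence $Y=X\setminus S_\sigma$. (c) The residue classes of the indeterminates in $Y=X\setminus Z$ form a $K$-vector space basis of the cotangent space $\mathfrak{m}/\mathfrak{m}^2$ of $P/I$ at the origin, where $\mathfrak{m}$ is the image of $\mathfrak{M}$ in $P/I$.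
   Context: $\mathrm{LT}_\sigma(J)$ denotes the leading term ideal of an ideal $J$ with respect to a term ordering $\sigma$ on the terms of $P$. Tuples of distinct indeterminates are identified with sets where convenient. The ideal $I\subseteq\mathfrak{M}$ is $Z$-separating if there exist a term ordering $\sigma$ and $f_1,\dots,f_s\in I\setminus\{0\}$ with $\mathrm{LT}_\sigma(f_i)=z_i$ for $i=1,\dots,s$; such a $\sigma$ is called a $Z$-separating term ordering for $I$. In this case the reduced $\sigma$-Gröbner basis of $I$ has the form $\{z_1-h_1,\dots,z_s-h_s,g_1,\dots,g_r\}$ with $h_i,g_j\in K[Y]$, and the $Z$-separating re-embedding of $I$ is the $K$-algebra isomorphism $\Phi:P/I\to K[Y]/(I\cap K[Y])$ given by $\Phi(\bar x_i)=\bar x_i$ for $x_i\in Y$ and $\Phi(\bar x_i)=\bar h_j$ for $x_i=z_j\in Z$. For $f\in\mathfrak{M}$, $\mathrm{Lin}_{\mathfrak{M}}(f)$ is the homogeneous component of $f$ of standard degree $1$, and $\mathrm{Lin}_{\mathfrak{M}}(I)=\langle \mathrm{Lin}_{\mathfrak{M}}(f)\mid f\in I\rangle_K$; $\langle\mathrm{Lin}_{\mathfrak{M}}(I)\rangle$ is the ideal of $P$ it generates. A re-embedding of $I$ is a $K$-algebra isomorphism $\Psi:P/I\to P'/I'$ where $P'$ is a polynomial ring over $K$ (in finitely many indeterminates) and $I'$ is an ideal of $P'$. It is called optimal if every $K$-algebra isomorphism $P/I\to P''/I''$, with $P''$ a polynomial ring over $K$ and $I''$ an ideal of $P''$, satisfies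 $\dim(P'')\ge\dim(P')$. *)

theory Defs
  imports
    "HOL-Library.Poly_Mapping"
    "HOL-Library.Extended_Nat"
    "HOL-Library.FuncSet"
    "HOL-Algebra.Embedded_Algebras"
    "HOL-Algebra.Ideal_Product"
    "HOL-Algebra.QuotRing"
begin

section \<open>Polynomial rings\<close>

text \<open>Exponent vectors, i.e. terms written additively: the term \<open>1\<close> is \<open>0\<close>, and
  multiplication of terms is \<open>+\<close>.\<close>

type_synonym pterm = "nat \<Rightarrow>\<^sub>0 nat"

type_synonym 'k mpol = "pterm \<Rightarrow>\<^sub>0 'k"

definition pterms :: "nat set \<Rightarrow> pterm set"
  where "pterms V = {t. Poly_Mapping.keys t \<subseteq> V}"

text \<open>\<open>pring V\<close> is the polynomial ring over the field \<open>'k\<close> in the indeterminates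
  \<open>x\<^sub>i\<close> with \<open>i \<in> V\<close>. For \<open>W \<subseteq> V\<close>, \<open>pring W\<close> is literally a subring of \<open>pring V\<close>.\<close>

definition pring :: "nat set \<Rightarrow> 'k::field mpol ring"
  where "pring V =
    \<lparr>carrier = {p. Poly_Mapping.keys p \<subseteq> pterms V}, mult = (*), one = 1, zero = 0, add = (+)\<rparr>"

definition pconst :: "'k::field \<Rightarrow> 'k mpol"
  where "pconst c = Poly_Mapping.single 0 c"

definition pmonom :: "pterm \<Rightarrow> 'k::field mpol"
  where "pmonom t = Poly_Mapping.single t 1"

definition tvar :: "nat \<Rightarrow> pterm"
  where "tvar i = Poly_Mapping.single i 1"

definition pvar :: "nat \<Rightarrow> 'k::field mpol"
  where "pvar i = pmonom (tvar i)"

lemma pring_cring: "cring (pring V :: 'k::field mpol ring)"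
proof (rule cringI)
  have add: "Poly_Mapping.keys (p + q) \<subseteq> pterms V"
    if "Poly_Mapping.keys p \<subseteq> pterms V" "Poly_Mapping.keys q \<subseteq> pterms V" for p q :: "'k mpol"
    using that keys_add[of p q] by blast
  have tadd: "s + t \<in> pterms V" if "s \<in> pterms V" "t \<in> pterms V" for s t
    using that keys_add[of s t] by (auto simp: pterms_def)
  have mult: "Poly_Mapping.keys (p * q) \<subseteq> pterms V"
    if "Poly_Mapping.keys p \<subseteq> pterms V" "Poly_Mapping.keys q \<subseteq> pterms V" for p q :: "'k mpol"
    using that keys_mult[of p q] tadd by blast
  show "abelian_group (pring V :: 'k mpol ring)"
  proof (rule abelian_groupI)
    fix x :: "'k mpol" assume "x \<in> carrier (pring V)"
    then show "\<exists>y\<in>carrier (pring V). y \<oplus>\<^bsub>pring V\<^esub> x = \<zero>\<^bsub>pring V\<^esub>"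
      by (intro bexI[of _ "- x"]) (auto simp: pring_def in_keys_iff)
  qed (auto simp: pring_def ac_simps dest: subsetD[OF add])
  show "Group.comm_monoid (pring V :: 'k mpol ring)"
    by (rule comm_monoidI) (auto simp: pring_def ac_simps pterms_def[of V] mult[unfolded pterms_def]
        dest: subsetD[OF mult[unfolded pterms_def]])
qed (simp add: pring_def algebra_simps)

definition origin_ideal :: "nat set \<Rightarrow> 'k::field mpol set"
  where "origin_ideal V = Idl\<^bsub>pring V\<^esub> (pvar ` V)"

section \<open>Leading terms and Groebner bases\<close>

text \<open>A term ordering is given by its non-strict relation: \<open>(s, t) \<in> \<sigma>\<close> means that
  \<open>s\<close> is at most \<open>t\<close>.\<close>

definition term_ordering :: "nat set \<Rightarrow> pterm rel \<Rightarrow> bool"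
  where "term_ordering V \<sigma> \<longleftrightarrow>
    linear_order_on (pterms V) \<sigma> \<and>
    (\<forall>s\<in>pterms V. \<forall>t\<in>pterms V. \<forall>u\<in>pterms V. (s, t) \<in> \<sigma> \<longrightarrow> (s + u, t + u) \<in> \<sigma>) \<and>
    (\<forall>t\<in>pterms V. (0, t) \<in> \<sigma>)"

text \<open>Only meaningful for \<open>f \<noteq> 0\<close>.\<close>

definition LT :: "pterm rel \<Rightarrow> 'k::field mpol \<Rightarrow> pterm"
  where "LT \<sigma> f =
    (THE t. t \<in> Poly_Mapping.keys f \<and> (\<forall>s\<in>Poly_Mapping.keys f. (s, t) \<in> \<sigma>))"

definition LT_ideal :: "nat set \<Rightarrow> pterm rel \<Rightarrow> 'k::field mpol set \<Rightarrow> 'k mpol set"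
  where "LT_ideal V \<sigma> J = Idl\<^bsub>pring V\<^esub> {pmonom (LT \<sigma> f) | f. f \<in> J \<and> f \<noteq> 0}"

definition term_dvd :: "pterm \<Rightarrow> pterm \<Rightarrow> bool"
  where "term_dvd s t \<longleftrightarrow> (\<exists>u. t = s + u)"

definition reduced_groebner_basis ::
    "nat set \<Rightarrow> pterm rel \<Rightarrow> 'k::field mpol set \<Rightarrow> 'k mpol set \<Rightarrow> bool"
  where "reduced_groebner_basis V \<sigma> J G \<longleftrightarrow>
    finite G \<and> G \<subseteq> J - {0} \<and>
    Idl\<^bsub>pring V\<^esub> ((\<lambda>g. pmonom (LT \<sigma> g)) ` G) = LT_ideal V \<sigma> J \<and>
    (\<forall>g\<in>G. Poly_Mapping.lookup g (LT \<sigma> g) = 1) \<and>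
    (\<forall>g\<in>G. \<forall>g'\<in>G - {g}. \<forall>t\<in>Poly_Mapping.keys g. \<not> term_dvd (LT \<sigma> g') t)"

section \<open>Re-embeddings\<close>

definition alg_hom ::
    "nat set \<Rightarrow> 'k::field mpol set \<Rightarrow> nat set \<Rightarrow> 'k mpol set \<Rightarrow> ('k mpol set \<Rightarrow> 'k mpol set) set"
  where "alg_hom V J W J' =
    {\<Phi> \<in> ring_hom (pring V Quot J) (pring W Quot J').
      \<forall>c. \<Phi> (J +>\<^bsub>pring V\<^esub> pconst c) = J' +>\<^bsub>pring W\<^esub> pconst c}"

definition alg_iso ::
    "nat set \<Rightarrow> 'k::field mpol set \<Rightarrow> nat set \<Rightarrow> 'k mpol set \<Rightarrow> ('k mpol set \<Rightarrow> 'k mpol set) set"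
  where "alg_iso V J W J' =
    alg_hom V J W J' \<inter> ring_iso (pring V Quot J) (pring W Quot J')"

definition re_embedding ::
    "nat set \<Rightarrow> 'k::field mpol set \<Rightarrow> nat set \<Rightarrow> 'k mpol set \<Rightarrow> ('k mpol set \<Rightarrow> 'k mpol set) \<Rightarrow> bool"
  where "re_embedding V J W J' \<Psi> \<longleftrightarrow>
    finite W \<and> ideal J' (pring W) \<and> \<Psi> \<in> alg_iso V J W J'"

text \<open>Krull dimension; it is used only for nonzero rings (the supremum makes the dimension of
  the zero ring \<open>0\<close>).\<close>

definition krull_dim :: "('a, 'b) ring_scheme \<Rightarrow> enat"
  where "krull_dim R =
    Sup {enat k | k. \<exists>p :: nat \<Rightarrow> 'a set.
      (\<forall>i\<le>k. primeideal (p i) R) \<and> (\<forall>i<k. p i \<subset> p (Suc i))}"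

definition optimal_re_embedding ::
    "nat set \<Rightarrow> 'k::field mpol set \<Rightarrow> nat set \<Rightarrow> 'k mpol set \<Rightarrow> ('k mpol set \<Rightarrow> 'k mpol set) \<Rightarrow> bool"
  where "optimal_re_embedding V J W J' \<Psi> \<longleftrightarrow>
    re_embedding V J W J' \<Psi> \<and>
    (\<forall>W'' J'' \<Psi>''. re_embedding V J W'' J'' \<Psi>'' \<longrightarrow>
      krull_dim (pring W :: 'k mpol ring) \<le> krull_dim (pring W'' :: 'k mpol ring))"

section \<open>Separating tuples of indeterminates\<close>

text \<open>A tuple \<open>Z\<close> of indeterminates is the list \<open>zs\<close> of their indices.\<close>

definition separating_ordering ::
    "nat set \<Rightarrow> nat list \<Rightarrow> 'k::field mpol set \<Rightarrow> pterm rel \<Rightarrow> bool"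
  where "separating_ordering V zs J \<sigma> \<longleftrightarrow>
    term_ordering V \<sigma> \<and>
    (\<exists>f :: nat \<Rightarrow> 'k mpol. \<forall>j<length zs. f j \<in> J - {0} \<and> LT \<sigma> (f j) = tvar (zs ! j))"

definition separating :: "nat set \<Rightarrow> nat list \<Rightarrow> 'k::field mpol set \<Rightarrow> bool"
  where "separating V zs J \<longleftrightarrow> (\<exists>\<sigma>. separating_ordering V zs J \<sigma>)"

text \<open>The unique map \<open>\<Phi> : P/J \<rightarrow> K[Y]/(J \<inter> K[Y])\<close> of \<open>K\<close>-algebras with \<open>x\<^sub>i \<mapsto> x\<^sub>i\<close> for
  \<open>i\<close> in \<open>Y\<close> and \<open>z\<^sub>j \<mapsto> h\<^sub>j\<close> (on residue classes), where \<open>G = {z\<^sub>j - h\<^sub>j} \<union> G'\<close> is the reduced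
  Groebner basis of \<open>J\<close> and \<open>h\<^sub>j \<in> K[Y]\<close>, \<open>G' \<subseteq> K[Y]\<close>. Membership in \<open>extensional\<close> only fixes the
  values of the HOL function outside of \<open>P/J\<close>, which makes it unique.\<close>

definition separating_re_embedding ::
    "nat set \<Rightarrow> nat list \<Rightarrow> pterm rel \<Rightarrow> 'k::field mpol set \<Rightarrow> 'k mpol set \<Rightarrow> 'k mpol set"
  where "separating_re_embedding V zs \<sigma> J =
    (THE \<Phi>. \<exists>G G' (h :: nat \<Rightarrow> 'k mpol).
      let Y = V - set zs; A = pring Y; J' = J \<inter> carrier A in
        reduced_groebner_basis V \<sigma> J G \<and>
        G = {pvar (zs ! j) - h j | j. j < length zs} \<union> G' \<and>
        G' \<subseteq> carrier A \<and>
        (\<forall>j<length zs. h j \<in> carrier A) \<and>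
        \<Phi> \<in> alg_hom V J Y J' \<and>
        \<Phi> \<in> extensional (carrier (pring V Quot J)) \<and>
        (\<forall>i\<in>Y. \<Phi> (J +>\<^bsub>pring V\<^esub> pvar i) = J' +>\<^bsub>A\<^esub> pvar i) \<and>
        (\<forall>j<length zs. \<Phi> (J +>\<^bsub>pring V\<^esub> pvar (zs ! j)) = J' +>\<^bsub>A\<^esub> h j))"

section \<open>Linear parts\<close>

definition term_degree :: "pterm \<Rightarrow> nat"
  where "term_degree t = (\<Sum>i\<in>Poly_Mapping.keys t. Poly_Mapping.lookup t i)"

definition hom_component :: "nat \<Rightarrow> 'k::field mpol \<Rightarrow> 'k mpol"
  where "hom_component d f =
    Poly_Mapping.mapp (\<lambda>t c. if term_degree t = d then c else 0) f"

definition lin :: "'k::field mpol \<Rightarrow> 'k mpol"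
  where "lin f = hom_component 1 f"

text \<open>\<open>K\<close>-linear algebra is done inside \<open>K\<close>-algebras, with \<open>K\<close> embedded as the subfield of
  constants; the span of a set is the union of the spans of finite lists of its elements.\<close>

definition Lin :: "nat set \<Rightarrow> 'k::field mpol set \<Rightarrow> 'k mpol set"
  where "Lin V J = \<Union>{ring.Span (pring V) (range pconst) us | us. set us \<subseteq> lin ` J}"

definition minimal_indet_generators :: "nat set \<Rightarrow> 'k::field mpol set \<Rightarrow> nat set \<Rightarrow> bool"
  where "minimal_indet_generators V J S \<longleftrightarrow>
    S \<subseteq> V \<and> Idl\<^bsub>pring V\<^esub> (pvar ` S) = J \<and> (\<forall>T\<subset>S. Idl\<^bsub>pring V\<^esub> (pvar ` T) \<noteq> J)"

text \<open>Existence: \<open>Lin V J\<close> is a space of linear forms, so the leading term ideal is generated by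
  indeterminates. Uniqueness: \<open>x\<^sub>i\<close> lies in the ideal generated by the \<open>x\<^sub>j\<close> with \<open>j \<in> S\<close> iff
  \<open>i \<in> S\<close>.\<close>

definition S_set :: "nat set \<Rightarrow> pterm rel \<Rightarrow> 'k::field mpol set \<Rightarrow> nat set"
  where "S_set V \<sigma> J =
    (THE S. minimal_indet_generators V (LT_ideal V \<sigma> (Idl\<^bsub>pring V\<^esub> (Lin V J))) S)"

section \<open>The cotangent space at the origin\<close>

definition max_image :: "nat set \<Rightarrow> 'k::field mpol set \<Rightarrow> 'k mpol set set"
  where "max_image V J = (\<lambda>f. J +>\<^bsub>pring V\<^esub> f) ` origin_ideal V"

definition max_image_sq :: "nat set \<Rightarrow> 'k::field mpol set \<Rightarrow> 'k mpol set set"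
  where "max_image_sq V J = ideal_prod (pring V Quot J) (max_image V J) (max_image V J)"

text \<open>The quotient \<open>\<mm>/\<mm>\<^sup>2\<close> is taken inside the \<open>K\<close>-algebra \<open>(P/J)/\<mm>\<^sup>2\<close>, whose multiplication by
  the image of \<open>K\<close> restricts to the \<open>K\<close>-vector space structure of \<open>\<mm>/\<mm>\<^sup>2\<close>.\<close>

definition cot_ring :: "nat set \<Rightarrow> 'k::field mpol set \<Rightarrow> 'k mpol set set ring"
  where "cot_ring V J = (pring V Quot J) Quot (max_image_sq V J)"

definition cot_class :: "nat set \<Rightarrow> 'k::field mpol set \<Rightarrow> 'k mpol \<Rightarrow> 'k mpol set set"
  where "cot_class V J f = max_image_sq V J +>\<^bsub>pring V Quot J\<^esub> (J +>\<^bsub>pring V\<^esub> f)"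

definition cot_scalars :: "nat set \<Rightarrow> 'k::field mpol set \<Rightarrow> 'k mpol set set set"
  where "cot_scalars V J = cot_class V J ` range pconst"

definition cotangent_space :: "nat set \<Rightarrow> 'k::field mpol set \<Rightarrow> 'k mpol set set set"
  where "cotangent_space V J =
    (\<lambda>a. max_image_sq V J +>\<^bsub>pring V Quot J\<^esub> a) ` max_image V J"

text \<open>\<open>us\<close> is a basis of the subspace \<open>E\<close> of the algebra \<open>R\<close> over its subfield \<open>K\<close>; independence
  of a list includes that its entries are distinct.\<close>

definition vs_basis :: "('a, 'b) ring_scheme \<Rightarrow> 'a set \<Rightarrow> 'a set \<Rightarrow> 'a list \<Rightarrow> bool"
  where "vs_basis R K E us \<longleftrightarrow> ring.independent R K us \<and> ring.Span R K us = E"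

end

theory Submission
  imports Defs
begin

text \<open>
  Since \<open>z\<^sub>j - h\<^sub>j \<in> I\<close> with \<open>h\<^sub>j \<in> K[Y]\<close>, every residue class of \<open>P/I\<close> meets \<open>K[Y]\<close>, and the
  re-embedding \<open>\<Phi>\<close> is simply \<open>C \<mapsto> C \<inter> K[Y]\<close>. The linear forms \<open>z\<^sub>j - lin h\<^sub>j\<close> lie in \<open>Lin(I)\<close>
  and are independent, hence by the dimension hypothesis they form a basis. So the substitution
  \<open>z\<^sub>j \<mapsto> lin h\<^sub>j\<close> kills \<open>Lin(I)\<close>; as it fixes \<open>K[Y]\<close> and replaces each \<open>z\<^sub>j\<close> by smaller terms, no
  nonzero polynomial in its kernel has its leading term in \<open>K[Y]\<close>, which gives (b). Composed with
  \<open>lin\<close>, the substitution becomes a derivation at the origin from \<open>P\<close> onto the span of \<open>Y\<close> that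
  vanishes on \<open>I\<close>; it identifies the cotangent space with this span. Given a second re-embedding
  into a quotient of \<open>K[W]\<close>, the values of this derivation at lifts of the indeterminates in \<open>W\<close>
  span the same space, so \<open>|Y| \<le> |W|\<close>.
\<close>

text \<open>The re-embedding is defined through a reduced Groebner basis, so one has to be produced;
  this is what Dickson's lemma and the normal forms are for. The same normal forms supply
  \<open>h\<close>: all terms of \<open>h z\<close> are at most \<open>z\<close>, a bound that
  passes to \<open>lin (h z)\<close> and ensures that the substitution never raises a term. The
  dimension hypothesis enters at one point: if \<open>Lin(I)\<close> were larger than the span of
  the forms \<open>z - lin (h z)\<close>, the substitution would not have to vanish on it. The
  derivation obeys D(fg) = f(0) D(g) + g(0) D(f) and kills constants. Therefore it vanishes on
  products of two elements of the maximal ideal, which makes it well defined on the cotangent space.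
  The same rule copes with the obstacle in the optimality claim, that a competing ideal in K[W] may
  miss the origin: lifts of the indeterminates may have any constant terms, since these enter the
  rule only as scalars.\<close>

abbreviation (input) "keys \<equiv> Poly_Mapping.keys"
abbreviation (input) "lookup \<equiv> Poly_Mapping.lookup"

section \<open>Polynomial rings\<close>

lemma pring_simps [simp]:
  "p \<otimes>\<^bsub>pring V\<^esub> q = p * q" "p \<oplus>\<^bsub>pring V\<^esub> q = p + q"
  "\<one>\<^bsub>pring V\<^esub> = 1" "\<zero>\<^bsub>pring V\<^esub> = 0"
  by (simp_all add: pring_def)

lemma carrier_pring_iff: "p \<in> carrier (pring V) \<longleftrightarrow> keys p \<subseteq> pterms V"
  by (simp add: pring_def)

lemma pring_ring: "ring (pring V :: 'k::field mpol ring)"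
  by (rule cring.axioms(1)[OF pring_cring])

lemma pterms_zero [simp]: "0 \<in> pterms V"
  by (simp add: pterms_def)

text \<open>Exponents are natural numbers and cannot cancel. This is why \<open>pterms V\<close> is
  closed under factors as well as under products.\<close>

lemma keys_pterm_add: "keys (s + t) = keys s \<union> keys t" for s t :: pterm
  by (auto simp: in_keys_iff lookup_add)

lemma pterms_add [simp]: "s + t \<in> pterms V \<longleftrightarrow> s \<in> pterms V \<and> t \<in> pterms V"
  by (auto simp: pterms_def keys_pterm_add)

lemma pterms_tvar [simp]: "tvar i \<in> pterms V \<longleftrightarrow> i \<in> V"
  by (simp add: pterms_def tvar_def)

lemma pterms_mono: "W \<subseteq> V \<Longrightarrow> pterms W \<subseteq> pterms V"
  by (auto simp: pterms_def)

lemma tvar_inj [simp]: "tvar i = tvar j \<longleftrightarrow> i = j"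
  by (metis keys_single one_neq_zero singleton_inject tvar_def)

lemma tvar_nonzero [simp]: "tvar i \<noteq> 0" "0 \<noteq> tvar i"
  by (metis keys_single keys_zero empty_not_insert one_neq_zero tvar_def)+

lemma pterm_induct [consumes 1, case_names zero tvar_add]:
  assumes "t \<in> pterms V" and zero: "Q 0"
    and step: "\<And>i t. i \<in> V \<Longrightarrow> t \<in> pterms V \<Longrightarrow> Q t \<Longrightarrow> Q (tvar i + t)"
  shows "Q t"
  using assms(1)
proof (induction "term_degree t" arbitrary: t rule: less_induct)
  case less
  show ?case
  proof (cases "t = 0")
    case False
    then obtain i where i: "i \<in> keys t"
      using keys_eq_empty by blast
    define u where "u = t - tvar i"
    \<comment> \<open>Subtraction of exponents is truncated; it is exact here because
      \<open>i\<close> occurs in \<open>t\<close>.\<close>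
    have t: "t = tvar i + u"
      using i by (intro poly_mapping_eqI)
        (auto simp: u_def lookup_add lookup_minus tvar_def lookup_single in_keys_iff when_def)
    have "term_degree u = (\<Sum>j\<in>keys t. lookup u j)"
      unfolding term_degree_def using t
      by (intro sum.mono_neutral_left) (auto simp: in_keys_iff lookup_add)
    also have "\<dots> < term_degree t"
      unfolding term_degree_def
      by (intro sum_strict_mono_ex1)
        (use i in \<open>auto simp: t lookup_add tvar_def intro!: bexI[of _ i]\<close>)
    finally show ?thesis
      using less step[of i u] t by simp
  qed (use zero in simp)
qed

lemma term_degree_add: "term_degree (s + t) = term_degree s + term_degree t"
proof -
  have deg: "term_degree u = (\<Sum>i\<in>keys s \<union> keys t. lookup u i)"
    if "keys u \<subseteq> keys s \<union> keys t" for u :: pterm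
    unfolding term_degree_def using that
    by (intro sum.mono_neutral_left) (auto simp: in_keys_iff)
  show ?thesis
    using deg[of "s + t"] deg[of s] deg[of t] keys_add[of s t]
    by (simp add: lookup_add sum.distrib)
qed

lemma term_degree_zero [simp]: "term_degree 0 = 0"
  and term_degree_tvar [simp]: "term_degree (tvar i) = 1"
  by (simp_all add: term_degree_def tvar_def)

lemma lookup_pconst_mult [simp]: "lookup (pconst c * p) t = c * lookup p t"
  unfolding pconst_def mult_map_scale_conv_mult[symmetric]
  by (simp add: Poly_Mapping.map.rep_eq when_def)

lemma lookup_pmonom: "lookup (pmonom s) t = (if s = t then 1 else 0)"
  by (simp add: pmonom_def lookup_single when_def)

lemma lookup_pvar: "lookup (pvar i) t = (if t = tvar i then 1 else 0)"
  by (auto simp: pvar_def lookup_pmonom)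

lemma lookup_pconst: "lookup (pconst c) t = (if t = 0 then c else 0)"
  by (auto simp: pconst_def lookup_single when_def)

lemma keys_pmonom [simp]: "keys (pmonom t :: 'k::field mpol) = {t}"
  by (simp add: pmonom_def)

lemma keys_pvar [simp]: "keys (pvar i :: 'k::field mpol) = {tvar i}"
  by (simp add: pvar_def)

lemma keys_pconst: "keys (pconst c) \<subseteq> {0}"
  by (simp add: pconst_def)

lemma keys_pconst_mult: "keys (pconst c * p) \<subseteq> keys p"
  by (auto simp: in_keys_iff)

lemma pmonom_add: "pmonom (s + t) = pmonom s * pmonom t"
  by (simp add: pmonom_def mult_single)

lemma pconst_simps [simp]:
  "pconst 0 = 0" "pconst 1 = 1" "pmonom 0 = 1"
  by (simp_all add: pconst_def pmonom_def)

lemma pconst_add: "pconst (a + b) = pconst a + pconst b"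
  and pconst_mult: "pconst (a * b) = pconst a * pconst b"
  and pconst_uminus: "pconst (- a) = - pconst a"
  by (simp_all add: pconst_def single_add mult_single single_uminus)

lemma pconst_mult_inverse: "c \<noteq> 0 \<Longrightarrow> pconst c * pconst (inverse c) = 1"
  by (simp add: pconst_mult[symmetric])

text \<open>The term 1 has only the trivial factorisation, so the convolution sum collapses to one
  summand.\<close>

lemma lookup_zero_mult: "lookup (p * q) (0::pterm) = lookup p 0 * lookup q (0::pterm)"
proof -
  have "lookup (p * q) 0 = (\<Sum>a. lookup p a * (\<Sum>b. lookup q b when 0 = a + b))"
    by (simp add: lookup_mult)
  also have "\<dots> = (\<Sum>a. (lookup p a * lookup q 0) when a = 0)"
  proof (intro Sum_any.cong)
    fix a :: pterm
    have "0 = a + b \<longleftrightarrow> a = 0 \<and> b = 0" for b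
      by (metis add.right_neutral add_0 keys_eq_empty keys_pterm_add keys_zero sup_eq_bot_iff)
    then have "(\<Sum>b. lookup q b when 0 = a + b) = ((\<Sum>b. lookup q b when b = 0) when a = 0)"
      by (cases "a = 0") simp_all
    then show "lookup p a * (\<Sum>b. lookup q b when 0 = a + b) = (lookup p a * lookup q 0 when a = 0)"
      by (auto simp: when_def)
  qed
  finally show ?thesis by simp
qed

lemma mpol_sum_monomials: "p = (\<Sum>t\<in>keys p. pconst (lookup p t) * pmonom t)"
  by (rule poly_mapping_eqI)
    (auto simp: lookup_sum lookup_pmonom if_distrib[of "(*) _"] in_keys_iff cong: if_cong)

lemma pring_closed [simp]:
  fixes p q :: "'k::field mpol"
  shows "0 \<in> carrier (pring V :: 'k mpol ring)" "1 \<in> carrier (pring V :: 'k mpol ring)"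
    and "pconst c \<in> carrier (pring V)"
    and "p \<in> carrier (pring V) \<Longrightarrow> - p \<in> carrier (pring V)"
    and "p \<in> carrier (pring V) \<Longrightarrow> q \<in> carrier (pring V) \<Longrightarrow> p + q \<in> carrier (pring V)"
    and "p \<in> carrier (pring V) \<Longrightarrow> q \<in> carrier (pring V) \<Longrightarrow> p - q \<in> carrier (pring V)"
    and "p \<in> carrier (pring V) \<Longrightarrow> q \<in> carrier (pring V) \<Longrightarrow> p * q \<in> carrier (pring V)"
  using ring.ring_simprules(1,5)[OF pring_ring[of V], of p q] keys_pconst[of c] keys_diff[of p q]
  by (auto simp: carrier_pring_iff)

lemma pring_vars_closed [simp]:
  "t \<in> pterms V \<Longrightarrow> pmonom t \<in> carrier (pring V)"
  "i \<in> V \<Longrightarrow> pvar i \<in> carrier (pring V)"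
  by (simp_all add: carrier_pring_iff)

lemma pring_sum_closed:
  "(\<And>x. x \<in> A \<Longrightarrow> f x \<in> carrier (pring V)) \<Longrightarrow> sum f A \<in> carrier (pring V)"
  by (induction A rule: infinite_finite_induct) auto

lemma pring_mono: "W \<subseteq> V \<Longrightarrow> p \<in> carrier (pring W) \<Longrightarrow> p \<in> carrier (pring V)"
  unfolding carrier_pring_iff by (blast dest: pterms_mono)

lemma pring_a_inv [simp]:
  assumes "(p :: 'k::field mpol) \<in> carrier (pring V)"
  shows "\<ominus>\<^bsub>pring V\<^esub> p = - p"
proof -
  interpret ring "pring V :: 'k mpol ring" by (rule pring_ring)
  show ?thesis using assms by (intro minus_equality) auto
qed

lemma pring_a_minus [simp]:
  assumes "(p :: 'k::field mpol) \<in> carrier (pring V)" "q \<in> carrier (pring V)"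
  shows "p \<ominus>\<^bsub>pring V\<^esub> q = p - q"
  using assms by (simp add: a_minus_def)

lemma pring_linear_induct [consumes 1, case_names pmonom add]:
  assumes "(p :: 'k::field mpol) \<in> carrier (pring V)"
    and monom: "\<And>c t. t \<in> pterms V \<Longrightarrow> Q (pconst c * pmonom t)"
    and add: "\<And>p q. p \<in> carrier (pring V) \<Longrightarrow> q \<in> carrier (pring V) \<Longrightarrow> Q p \<Longrightarrow> Q q \<Longrightarrow> Q (p + q)"
  shows "Q p"
proof -
  have sub: "keys p \<subseteq> pterms V"
    using assms(1) by (simp add: carrier_pring_iff)
  have "Q (\<Sum>t\<in>T. pconst (lookup p t) * pmonom t)" if "finite T" "T \<subseteq> pterms V" for T
    using that
  proof (induction T)
    case empty
    then show ?case using monom[of 0 0] by simp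
  next
    case (insert t T)
    then show ?case
      by (auto intro!: add monom pring_sum_closed)
  qed
  from this[OF finite_keys sub] show ?thesis
    by (simp flip: mpol_sum_monomials)
qed

text \<open>Polynomials are generated as an algebra by constants and indeterminates. This is the
  form suited to ring homomorphisms and residue classes; \<open>pring_linear_induct\<close> serves
  for maps that are merely linear.\<close>

lemma pring_induct [consumes 1, case_names pconst pvar add mult]:
  assumes "(p :: 'k::field mpol) \<in> carrier (pring V)"
    and pconst: "\<And>c. Q (pconst c)" and pvar: "\<And>i. i \<in> V \<Longrightarrow> Q (pvar i)"
    and add: "\<And>p q. p \<in> carrier (pring V) \<Longrightarrow> q \<in> carrier (pring V) \<Longrightarrow> Q p \<Longrightarrow> Q q \<Longrightarrow> Q (p + q)"
    and mult: "\<And>p q. p \<in> carrier (pring V) \<Longrightarrow> q \<in> carrier (pring V) \<Longrightarrow> Q p \<Longrightarrow> Q q \<Longrightarrow> Q (p * q)"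
  shows "Q p"
  using assms(1)
proof (induction rule: pring_linear_induct)
  case (pmonom c t)
  from pmonom have "Q (pmonom t)"
  proof (induction rule: pterm_induct)
    case zero
    then show ?case using pconst[of 1] by simp
  next
    case (tvar_add i t)
    then show ?case using mult[OF _ _ pvar] by (simp add: pmonom_add flip: pvar_def)
  qed
  with pmonom show ?case by (intro mult pconst) auto
qed (use add in auto)

section \<open>Ideals\<close>

lemma pideal_closed:
  fixes J :: "'k::field mpol set"
  assumes "ideal J (pring V)"
  shows "p \<in> J \<Longrightarrow> p \<in> carrier (pring V)" and "0 \<in> J"
    and "p \<in> J \<Longrightarrow> q \<in> J \<Longrightarrow> p + q \<in> J" and "p \<in> J \<Longrightarrow> - p \<in> J"
    and "p \<in> J \<Longrightarrow> q \<in> J \<Longrightarrow> p - q \<in> J"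
    and "p \<in> J \<Longrightarrow> q \<in> carrier (pring V) \<Longrightarrow> q * p \<in> J"
    and "p \<in> J \<Longrightarrow> q \<in> carrier (pring V) \<Longrightarrow> p * q \<in> J"
proof -
  interpret ideal J "pring V" by fact
  show carr: "p \<in> carrier (pring V)" if "p \<in> J" for p using that by (rule Icarr)
  show zero: "0 \<in> J" using additive_subgroup.zero_closed[OF ideal.axioms(1)[OF assms]] by simp
  show add: "p + q \<in> J" if "p \<in> J" "q \<in> J" for p q using additive_subgroup.a_closed[OF ideal.axioms(1)[OF assms] that] by simp
  show neg: "- p \<in> J" if "p \<in> J" for p
    using additive_subgroup.a_inv_closed[OF ideal.axioms(1)[OF assms] that] carr[OF that] by simp
  show "p - q \<in> J" if "p \<in> J" "q \<in> J" using add[OF that(1) neg[OF that(2)]] by simp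
  show "q * p \<in> J" "p * q \<in> J" if "p \<in> J" "q \<in> carrier (pring V)"
    using I_l_closed[OF that] I_r_closed[OF that] by simp_all
qed

lemma pideal_sum_closed:
  fixes J :: "'k::field mpol set"
  assumes "ideal J (pring V)" "\<And>x. x \<in> A \<Longrightarrow> f x \<in> J"
  shows "sum f A \<in> J"
  using assms(2) by (induction A rule: infinite_finite_induct) (auto intro: pideal_closed[OF assms(1)])

lemma pidealI:
  fixes J :: "'k::field mpol set"
  assumes "J \<subseteq> carrier (pring V)" "0 \<in> J" "\<And>p q. p \<in> J \<Longrightarrow> q \<in> J \<Longrightarrow> p + q \<in> J"
    and "\<And>p q. p \<in> J \<Longrightarrow> q \<in> carrier (pring V) \<Longrightarrow> q * p \<in> J"
  shows "ideal J (pring V)"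
proof (rule idealI[OF pring_ring])
  interpret ring "pring V :: 'k mpol ring" by (rule pring_ring)
  show "subgroup J (add_monoid (pring V))"
  proof (rule add.subgroupI)
    fix p assume "p \<in> J"
    then show "\<ominus>\<^bsub>pring V\<^esub> p \<in> J"
      using assms(1) assms(4)[of p "- 1"] by auto
  qed (use assms in auto)
qed (use assms in \<open>auto simp: mult.commute\<close>)

lemma pideal_coset_eq_iff:
  fixes J :: "'k::field mpol set"
  assumes "ideal J (pring V)" "p \<in> carrier (pring V)" "q \<in> carrier (pring V)"
  shows "J +>\<^bsub>pring V\<^esub> p = J +>\<^bsub>pring V\<^esub> q \<longleftrightarrow> p - q \<in> J"
  using ring.quotient_eq_iff_same_a_r_cos[OF pring_ring assms] assms by simp

lemma carrier_Quot: "carrier (R Quot J) = (\<lambda>a. J +>\<^bsub>R\<^esub> a) ` carrier R"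
  by (auto simp: FactRing_def A_RCOSETS_def')

lemma pideal_coset_mem_iff:
  "(x :: 'k::field mpol) \<in> J +>\<^bsub>pring V\<^esub> p \<longleftrightarrow> x - p \<in> J"
  by (auto simp: a_r_coset_def' intro!: bexI[of _ "x - p"])

text \<open>Membership in a monomial ideal is decided term by term: the right-hand side is an ideal
  containing the generators, and each monomial of one of its elements is a multiple of a generator.
  Questions about leading term ideals thus become questions about sets of terms.\<close>

lemma Idl_pmonom:
  fixes T :: "pterm set"
  assumes "T \<subseteq> pterms V"
  shows "Idl\<^bsub>pring V\<^esub> (pmonom ` T) =
    {p :: 'k::field mpol. p \<in> carrier (pring V) \<and> (\<forall>t\<in>keys p. \<exists>s\<in>T. term_dvd s t)}" (is "?I = ?M")
proof
  interpret ring "pring V :: 'k mpol ring" by (rule pring_ring)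
  have sub: "pmonom ` T \<subseteq> carrier (pring V :: 'k mpol ring)"
    using assms by auto
  have "ideal ?M (pring V)"
  proof (rule pidealI)
    fix p q :: "'k mpol" assume pq: "p \<in> ?M" "q \<in> ?M"
    show "p + q \<in> ?M"
      using pq keys_add[of p q] by auto
  next
    fix p q :: "'k mpol" assume pq: "p \<in> ?M" "q \<in> carrier (pring V)"
    have "\<exists>s\<in>T. term_dvd s (a + b)" if "b \<in> keys p" for a b
      using pq(1) that unfolding term_dvd_def by (fastforce simp: add_ac)
    then show "q * p \<in> ?M"
      using pq keys_mult[of q p] by auto
  qed auto
  moreover have "pmonom ` T \<subseteq> ?M"
    using sub by (auto simp: term_dvd_def intro!: bexI exI[of _ 0])
  ultimately show "?I \<subseteq> ?M" by (rule genideal_minimal)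
  show "?M \<subseteq> ?I"
  proof
    fix p assume p: "p \<in> ?M"
    note id = genideal_ideal[OF sub]
    have "pconst (lookup p t) * pmonom t \<in> ?I" if t: "t \<in> keys p" for t
    proof -
      obtain s u where s: "s \<in> T" "t = s + u"
        using p t unfolding term_dvd_def by blast
      have "u \<in> pterms V"
        using p t s by (auto simp: carrier_pring_iff)
      have "pmonom s \<in> ?I"
        using genideal_self[OF sub] s by auto
      with id have "(pconst (lookup p t) * pmonom u) * pmonom s \<in> ?I"
        using \<open>u \<in> _\<close> by (auto intro: pideal_closed(6))
      then show ?thesis by (simp add: s pmonom_add mult_ac)
    qed
    then have "(\<Sum>t\<in>keys p. pconst (lookup p t) * pmonom t) \<in> ?I"
      by (intro pideal_sum_closed[OF id])
    then show "p \<in> ?I"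
      by (simp flip: mpol_sum_monomials)
  qed
qed

lemma Idl_pvar:
  assumes "S \<subseteq> V"
  shows "Idl\<^bsub>pring V\<^esub> (pvar ` S) =
    {p :: 'k::field mpol. p \<in> carrier (pring V) \<and> (\<forall>t\<in>keys p. \<exists>i\<in>S. i \<in> keys t)}"
proof -
  have dvd: "term_dvd (tvar i) t \<longleftrightarrow> i \<in> keys t" for i t
  proof
    assume "i \<in> keys t"
    then have "t = tvar i + (t - tvar i)"
      by (intro poly_mapping_eqI)
        (auto simp: lookup_add lookup_minus tvar_def lookup_single in_keys_iff when_def)
    then show "term_dvd (tvar i) t" by (auto simp: term_dvd_def)
  qed (auto simp: term_dvd_def tvar_def in_keys_iff lookup_add)
  have "pvar ` S = (pmonom ` tvar ` S :: 'k mpol set)"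
    by (auto simp: pvar_def)
  moreover have "tvar ` S \<subseteq> pterms V"
    using assms by auto
  ultimately show ?thesis
    using Idl_pmonom[of "tvar ` S" V, where ?'k = 'k] by (simp add: dvd)
qed

text \<open>A term of \<open>pterms V\<close> other than 1 is divisible by some indeterminate in
  \<open>V\<close>, so only the constant term can obstruct membership.\<close>

lemma origin_ideal_iff:
  "p \<in> origin_ideal V \<longleftrightarrow> (p :: 'k::field mpol) \<in> carrier (pring V) \<and> lookup p 0 = 0"
proof -
  have "(\<exists>i\<in>V. i \<in> keys t) \<longleftrightarrow> t \<noteq> 0" if "t \<in> pterms V" for t
    using that keys_eq_empty[of t] by (fastforce simp: pterms_def)
  then have "(\<forall>t\<in>keys p. \<exists>i\<in>V. i \<in> keys t) \<longleftrightarrow> 0 \<notin> keys p" if "keys p \<subseteq> pterms V"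
    using that by blast
  then show ?thesis
    unfolding origin_ideal_def Idl_pvar[OF subset_refl] carrier_pring_iff
      not_in_keys_iff_lookup_eq_zero[symmetric] by blast
qed

text \<open>The set \<open>S\<close> is recovered as the set of indices of the indeterminates lying
  in the ideal. Both the minimality and the uniqueness of the generating set in \<open>S_set\<close>
  follow from this.\<close>

lemma Idl_pvar_inj:
  assumes "S \<subseteq> V" "T \<subseteq> V" "Idl\<^bsub>pring V\<^esub> (pvar ` S) = Idl\<^bsub>pring V\<^esub> (pvar ` T :: 'k::field mpol set)"
  shows "S = T"
proof -
  have mem: "i \<in> S \<longleftrightarrow> (pvar i :: 'k mpol) \<in> Idl\<^bsub>pring V\<^esub> (pvar ` S)" if "S \<subseteq> V" "i \<in> V" for i S
    using that by (simp add: Idl_pvar) (simp add: tvar_def)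
  have "i \<in> S \<longleftrightarrow> i \<in> T" for i
  proof (cases "i \<in> V")
    case True
    show ?thesis
      unfolding mem[OF assms(1) True] mem[OF assms(2) True] assms(3) ..
  qed (use assms(1,2) in blast)
  then show ?thesis by blast
qed

section \<open>Evaluation homomorphisms\<close>

definition term_eval :: "(nat \<Rightarrow> 'k::field mpol) \<Rightarrow> pterm \<Rightarrow> 'k mpol"
  where "term_eval \<eta> t = (\<Prod>i\<in>keys t. \<eta> i ^ lookup t i)"

text \<open>All rings \<open>pring V\<close> share one type, so this single function represents
  every substitution homomorphism between them; the values of \<open>\<eta>\<close> determine the
  target ring, see \<open>peval_ring_hom\<close>.\<close>

definition peval :: "(nat \<Rightarrow> 'k::field mpol) \<Rightarrow> 'k mpol \<Rightarrow> 'k mpol"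
  where "peval \<eta> p = (\<Sum>t\<in>keys p. pconst (lookup p t) * term_eval \<eta> t)"

lemma term_eval_zero [simp]: "term_eval \<eta> 0 = 1"
  by (simp add: term_eval_def)

lemma term_eval_tvar [simp]: "term_eval \<eta> (tvar i) = \<eta> i"
  by (simp add: term_eval_def tvar_def)

lemma term_eval_add: "term_eval \<eta> (s + t) = term_eval \<eta> s * term_eval \<eta> t"
proof -
  have ev: "term_eval \<eta> u = (\<Prod>i\<in>keys s \<union> keys t. \<eta> i ^ lookup u i)"
    if "keys u \<subseteq> keys s \<union> keys t" for u
    unfolding term_eval_def using that
    by (intro prod.mono_neutral_left) (auto simp: in_keys_iff)
  show ?thesis
    using ev[of "s + t"] ev[of s] ev[of t]
    by (simp add: keys_pterm_add lookup_add power_add prod.distrib)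
qed

lemma peval_superset:
  "finite T \<Longrightarrow> keys p \<subseteq> T \<Longrightarrow> peval \<eta> p = (\<Sum>t\<in>T. pconst (lookup p t) * term_eval \<eta> t)"
  unfolding peval_def by (intro sum.mono_neutral_left) (auto simp: in_keys_iff)

lemma peval_add: "peval \<eta> (p + q) = peval \<eta> p + peval \<eta> q"
  using peval_superset[of "keys p \<union> keys q" _ \<eta>] keys_add[of p q]
  by (simp add: lookup_add pconst_add algebra_simps sum.distrib)

lemma peval_monomial [simp]: "peval \<eta> (pconst c * pmonom t) = pconst c * term_eval \<eta> t"
  using peval_superset[of "{t}" "pconst c * pmonom t" \<eta>] keys_pconst_mult[of c "pmonom t"]
  by (simp add: lookup_pmonom)

lemma peval_pmonom [simp]: "peval \<eta> (pmonom t) = term_eval \<eta> t"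
  using peval_monomial[of \<eta> 1 t] by simp

lemma peval_pconst [simp]: "peval \<eta> (pconst c) = pconst c"
  using peval_monomial[of \<eta> c 0] by simp

lemma peval_pvar [simp]: "peval \<eta> (pvar i) = \<eta> i"
  by (simp add: pvar_def)

lemma peval_zero [simp]: "peval \<eta> 0 = 0" and peval_one [simp]: "peval \<eta> 1 = 1"
  using peval_pconst[of \<eta> 0] peval_pconst[of \<eta> 1] by simp_all

text \<open>Lets the induction rules for \<open>pring V\<close> prove identities that hold for all
  polynomials, without carrier conditions.\<close>

lemma carrier_pring_UNIV [simp]: "p \<in> carrier (pring UNIV)"
  by (simp add: carrier_pring_iff pterms_def)

lemma peval_mult: "peval \<eta> (p * q) = peval \<eta> p * peval \<eta> q"
proof (induction p rule: pring_linear_induct[OF carrier_pring_UNIV, case_names pmonom add])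
  case (pmonom c s)
  show ?case
  proof (induction q rule: pring_linear_induct[OF carrier_pring_UNIV, case_names pmonom add])
    case (pmonom d t)
    have eq: "(pconst c * pmonom s) * (pconst d * pmonom t) = pconst (c * d) * pmonom (s + t)"
      by (simp add: pconst_mult pmonom_add mult_ac)
    show ?case
      unfolding eq peval_monomial by (simp add: pconst_mult term_eval_add mult_ac)
  next
    case (add q q')
    then show ?case by (simp add: peval_add distrib_left)
  qed
next
  case (add p p')
  then show ?case by (simp add: peval_add distrib_right)
qed

lemma peval_uminus: "peval \<eta> (- p) = - peval \<eta> p"
  using peval_add[of \<eta> p "- p"] by (simp add: eq_neg_iff_add_eq_0 add.commute)

lemma peval_diff: "peval \<eta> (p - q) = peval \<eta> p - peval \<eta> q"
  using peval_add[of \<eta> p "- q"] by (simp add: peval_uminus)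

lemma peval_sum: "peval \<eta> (sum f A) = (\<Sum>x\<in>A. peval \<eta> (f x))"
  by (induction A rule: infinite_finite_induct) (simp_all add: peval_add)

lemma peval_closed:
  assumes "p \<in> carrier (pring V)" "\<And>i. i \<in> V \<Longrightarrow> \<eta> i \<in> carrier (pring W)"
  shows "peval \<eta> p \<in> carrier (pring W)"
  using assms(1)
  by (induction rule: pring_induct) (auto simp: peval_add peval_mult assms(2))

lemma peval_id:
  assumes "p \<in> carrier (pring V)" "\<And>i. i \<in> V \<Longrightarrow> \<eta> i = pvar i"
  shows "peval \<eta> p = p"
  using assms(1)
  by (induction rule: pring_induct) (auto simp: peval_add peval_mult assms(2))

lemma peval_ring_hom:
  assumes "\<And>i. i \<in> V \<Longrightarrow> \<eta> i \<in> carrier (pring W)"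
  shows "peval \<eta> \<in> ring_hom (pring V) (pring W)"
  by (rule ring_hom_memI) (auto simp: peval_add peval_mult intro: peval_closed assms)

section \<open>Term orderings\<close>

lemma lookup_pmonom_mult: "lookup (pmonom u * p) (u + t) = lookup p t"
proof (induction p rule: pring_linear_induct[OF carrier_pring_UNIV, case_names pmonom add])
  case (pmonom c s)
  have eq: "pmonom u * (pconst c * pmonom s) = pconst c * pmonom (u + s)"
    by (simp add: pmonom_add mult_ac)
  show ?case
    unfolding eq by (simp add: lookup_pmonom)
qed (simp_all add: lookup_add distrib_left)

lemma keys_pmonom_mult: "keys (pmonom u * p) = (\<lambda>t. u + t) ` keys p"
proof
  show "keys (pmonom u * p) \<subseteq> (\<lambda>t. u + t) ` keys p"
    using keys_mult[of "pmonom u" p] by auto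
  show "(\<lambda>t. u + t) ` keys p \<subseteq> keys (pmonom u * p)"
    by (auto simp: in_keys_iff lookup_pmonom_mult)
qed

section \<open>Dickson's lemma\<close>

lemma nat_mono_subseq:
  fixes s :: "nat \<Rightarrow> nat"
  obtains r :: "nat \<Rightarrow> nat" where "strict_mono r" "mono (\<lambda>n. s (r n))"
proof -
  obtain r :: "nat \<Rightarrow> nat" where r: "strict_mono r" "monoseq (\<lambda>n. s (r n))"
    using seq_monosub[of s] by blast
  show thesis
  proof (cases "mono (\<lambda>n. s (r n))")
    case False
    with r(2) have dec: "\<And>m n. m \<le> n \<Longrightarrow> s (r n) \<le> s (r m)"
      by (auto simp: monoseq_def mono_def)
    \<comment> \<open>A non-increasing sequence of natural numbers is constant from the point where
      it attains its minimum.\<close>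
    obtain m where m: "\<And>n. s (r m) \<le> s (r n)"
      using ex_has_least_nat[of "\<lambda>_. True" 0 "\<lambda>n. s (r n)"] by auto
    have "s (r (m + n)) = s (r m)" for n
      using dec[of m "m + n"] m[of "m + n"] by simp
    then have "mono (\<lambda>n. s (r (m + n)))" by (simp add: mono_def)
    moreover have "strict_mono (\<lambda>n. r (m + n))"
      using r(1) by (simp add: strict_mono_def)
    ultimately show thesis using that by blast
  qed (use r that in blast)
qed

text \<open>Passing to subsequences, one indeterminate at a time, makes all exponents monotone along
  a common subsequence; its first two members then divide one another.\<close>

lemma dickson:
  assumes "finite V" "\<And>n. T n \<in> pterms V"
  obtains i j :: nat where "i < j" "term_dvd (T i) (T j)"
proof -
  have "\<exists>r :: nat \<Rightarrow> nat. strict_mono r \<and> (\<forall>x\<in>V. mono (\<lambda>n. lookup (T (r n)) x))"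
    using assms(1)
  proof (induction V)
    case empty
    then show ?case by (auto simp: strict_mono_def intro: exI[of _ "\<lambda>n. n"])
  next
    case (insert x V)
    then obtain r :: "nat \<Rightarrow> nat"
      where r: "strict_mono r" "\<forall>x\<in>V. mono (\<lambda>n. lookup (T (r n)) x)" by blast
    obtain r' :: "nat \<Rightarrow> nat"
      where r': "strict_mono r'" "mono (\<lambda>n. lookup (T (r (r' n))) x)"
      using nat_mono_subseq[of "\<lambda>n. lookup (T (r n)) x"] by blast
    have "strict_mono (\<lambda>n. r (r' n))"
      using r(1) r'(1) by (simp add: strict_mono_def)
    moreover have "mono (\<lambda>n. lookup (T (r (r' n))) y)" if "y \<in> V" for y
      using r(2) that strict_mono_mono[OF r'(1)] by (auto simp: mono_def)
    ultimately show ?case using r'(2) by blast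
  qed
  then obtain r :: "nat \<Rightarrow> nat"
    where r: "strict_mono r" "\<forall>x\<in>V. mono (\<lambda>n. lookup (T (r n)) x)" by blast
  \<comment> \<open>Outside of \<open>V\<close> the exponents are 0.\<close>
  have le: "lookup (T (r 0)) x \<le> lookup (T (r 1)) x" for x
  proof (cases "x \<in> V")
    case True
    then show ?thesis using r(2) by (auto simp: mono_def)
  next
    case False
    then have "x \<notin> keys (T (r 0))" using assms(2) by (auto simp: pterms_def)
    then show ?thesis by (simp add: in_keys_iff)
  qed
  have "T (r 1) = T (r 0) + (T (r 1) - T (r 0))"
    by (rule poly_mapping_eqI) (simp add: lookup_add lookup_minus le[simplified])
  then have "term_dvd (T (r 0)) (T (r 1))"
    unfolding term_dvd_def by blast
  moreover have "r 0 < r 1" using r(1) by (simp add: strict_mono_def)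
  ultimately show thesis using that by blast
qed

section \<open>Leading terms, normal forms and reduced Groebner bases\<close>

definition lead_terms :: "pterm rel \<Rightarrow> 'k::field mpol set \<Rightarrow> pterm set"
  where "lead_terms \<sigma> J = LT \<sigma> ` (J - {0})"

lemma LT_ideal_eq: "LT_ideal V \<sigma> J = Idl\<^bsub>pring V\<^esub> (pmonom ` lead_terms \<sigma> J)"
proof -
  have "{pmonom (LT \<sigma> f) | f. f \<in> J \<and> f \<noteq> 0} = (pmonom ` lead_terms \<sigma> J :: 'a mpol set)"
    by (auto simp: lead_terms_def)
  then show ?thesis by (simp add: LT_ideal_def)
qed

definition minimal_terms :: "pterm set \<Rightarrow> pterm set"
  where "minimal_terms L = {t \<in> L. \<forall>s\<in>L. term_dvd s t \<longrightarrow> s = t}"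

lemma minimal_terms_dvd:
  assumes "t \<in> L"
  obtains s where "s \<in> minimal_terms L" "term_dvd s t"
  using assms
proof (induction "term_degree t" arbitrary: t thesis rule: less_induct)
  case less
  show ?case
  proof (cases "t \<in> minimal_terms L")
    case True
    then show ?thesis
      using less.prems(1)[of t] by (auto simp: term_dvd_def intro: exI[of _ 0])
  next
    case False
    then obtain s u where s: "s \<in> L" "t = s + u" "u \<noteq> 0"
      using less.prems(2) by (auto simp: minimal_terms_def term_dvd_def)
    then obtain i where i: "i \<in> keys u"
      using keys_eq_empty by blast
    then have "lookup u i \<le> term_degree u"
      unfolding term_degree_def by (intro member_le_sum) auto
    with i have "term_degree s < term_degree t"
      by (simp add: s(2) term_degree_add in_keys_iff)
    then obtain s' where "s' \<in> minimal_terms L" "term_dvd s' s"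
      using less.hyps[of s] s(1) by blast
    then show ?thesis
      using less.prems(1)[of s'] s(2) by (auto simp: term_dvd_def add.assoc)
  qed
qed

text \<open>Distinct minimal terms do not divide each other, whereas Dickson's lemma finds a
  divisibility in every sequence.\<close>

lemma finite_minimal_terms:
  assumes "finite V" "L \<subseteq> pterms V"
  shows "finite (minimal_terms L)"
proof (rule ccontr)
  assume "infinite (minimal_terms L)"
  then obtain T :: "nat \<Rightarrow> pterm" where T: "inj T" "range T \<subseteq> minimal_terms L"
    using infinite_countable_subset by blast
  moreover have "minimal_terms L \<subseteq> pterms V"
    using assms(2) by (auto simp: minimal_terms_def)
  ultimately have "T n \<in> pterms V" for n
    by blast
  then obtain i j :: nat where "i < j" "term_dvd (T i) (T j)"
    using dickson[OF assms(1), of T] by metis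
  moreover have "T i \<in> minimal_terms L" "T j \<in> minimal_terms L"
    using T(2) by auto
  ultimately have "T i = T j" "i \<noteq> j"
    by (auto simp: minimal_terms_def)
  with T(1) show False by (auto dest: injD)
qed

locale term_order =
  fixes V :: "nat set" and \<sigma> :: "pterm rel"
  assumes finite_indets: "finite V" and ordering: "term_ordering V \<sigma>"
begin

lemma ord_refl: "t \<in> pterms V \<Longrightarrow> (t, t) \<in> \<sigma>"
  and ord_trans: "(s, t) \<in> \<sigma> \<Longrightarrow> (t, u) \<in> \<sigma> \<Longrightarrow> (s, u) \<in> \<sigma>"
  and ord_antisym: "(s, t) \<in> \<sigma> \<Longrightarrow> (t, s) \<in> \<sigma> \<Longrightarrow> s = t"
  and ord_total: "s \<in> pterms V \<Longrightarrow> t \<in> pterms V \<Longrightarrow> (s, t) \<in> \<sigma> \<or> (t, s) \<in> \<sigma>"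
  and ord_add: "s \<in> pterms V \<Longrightarrow> t \<in> pterms V \<Longrightarrow> u \<in> pterms V \<Longrightarrow> (s, t) \<in> \<sigma> \<Longrightarrow> (s + u, t + u) \<in> \<sigma>"
  and ord_zero: "t \<in> pterms V \<Longrightarrow> (0, t) \<in> \<sigma>"
proof -
  have lin: "linear_order_on (pterms V) \<sigma>"
    using ordering by (simp add: term_ordering_def)
  then show refl: "t \<in> pterms V \<Longrightarrow> (t, t) \<in> \<sigma>" for t
    by (auto simp: order_on_defs refl_on_def)
  show "(s, t) \<in> \<sigma> \<Longrightarrow> (t, u) \<in> \<sigma> \<Longrightarrow> (s, u) \<in> \<sigma>"
    using lin by (auto simp: order_on_defs dest: transD)
  show "(s, t) \<in> \<sigma> \<Longrightarrow> (t, s) \<in> \<sigma> \<Longrightarrow> s = t"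
    using lin by (auto simp: order_on_defs dest: antisymD)
  show "s \<in> pterms V \<Longrightarrow> t \<in> pterms V \<Longrightarrow> (s, t) \<in> \<sigma> \<or> (t, s) \<in> \<sigma>"
    using lin refl[of s] by (cases "s = t") (auto simp: order_on_defs total_on_def)
qed (use ordering in \<open>auto simp: term_ordering_def\<close>)

lemma ord_add_mono:
  assumes "s \<in> pterms V" "t \<in> pterms V" "s' \<in> pterms V" "t' \<in> pterms V"
    and "(s, t) \<in> \<sigma>" "(s', t') \<in> \<sigma>"
  shows "(s + s', t + t') \<in> \<sigma>"
  using ord_add[of s t s'] ord_add[of s' t' t] assms by (auto simp: add.commute intro: ord_trans)

lemma ord_add_self:
  assumes "s \<in> pterms V" "u \<in> pterms V"
  shows "(s, s + u) \<in> \<sigma>"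
  using ord_add[of 0 u s] ord_zero assms by (simp add: add.commute)

text \<open>A term ordering refines divisibility. In an infinite descending chain, Dickson's lemma
  yields an earlier member dividing a later one, hence at most as large, against strict
  descent.\<close>

lemma wf_ord: "wf {(s, t). s \<in> pterms V \<and> t \<in> pterms V \<and> (s, t) \<in> \<sigma> \<and> s \<noteq> t}"
  unfolding wf_iff_no_infinite_down_chain
proof
  assume "\<exists>f. \<forall>i. (f (Suc i), f i) \<in> {(s, t). s \<in> pterms V \<and> t \<in> pterms V \<and> (s, t) \<in> \<sigma> \<and> s \<noteq> t}"
  then obtain f where f: "\<And>i. f i \<in> pterms V" "\<And>i. (f (Suc i), f i) \<in> \<sigma>" "\<And>i. f (Suc i) \<noteq> f i"
    by blast
  have dec: "(f j, f i) \<in> \<sigma>" if "i \<le> j" for i j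
    using that
  proof (induction j rule: dec_induct)
    case base
    then show ?case using f(1) by (rule ord_refl)
  next
    case (step j)
    then show ?case using ord_trans[OF f(2)] by blast
  qed
  obtain i j :: nat where ij: "i < j" "term_dvd (f i) (f j)"
    using dickson[OF finite_indets, of f] f(1) by metis
  then have "(f i, f j) \<in> \<sigma>"
    using f(1)[of i] f(1)[of j] ord_add_self by (auto simp: term_dvd_def)
  with dec[of "Suc i" j] ij(1) have "(f i, f (Suc i)) \<in> \<sigma>"
    using ord_trans by (auto simp: Suc_le_eq)
  with f(2,3)[of i] show False
    using ord_antisym by blast
qed

lemma LT_eqI:
  assumes "t \<in> keys f" "\<And>s. s \<in> keys f \<Longrightarrow> (s, t) \<in> \<sigma>"
  shows "LT \<sigma> f = t"
  unfolding LT_def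
proof (rule the_equality)
  fix t' assume "t' \<in> keys f \<and> (\<forall>s\<in>keys f. (s, t') \<in> \<sigma>)"
  with assms show "t' = t" by (blast intro: ord_antisym)
qed (use assms in blast)

lemma LT_props:
  assumes "f \<in> carrier (pring V)" "f \<noteq> 0"
  shows "LT \<sigma> f \<in> keys f" "\<And>s. s \<in> keys f \<Longrightarrow> (s, LT \<sigma> f) \<in> \<sigma>"
proof -
  have "\<exists>t\<in>T. \<forall>s\<in>T. (s, t) \<in> \<sigma>" if "finite T" "T \<noteq> {}" "T \<subseteq> pterms V" for T
    using that
  proof (induction T rule: finite_ne_induct)
    case (singleton t)
    then show ?case by (simp add: ord_refl)
  next
    case (insert x T)
    then obtain t where t: "t \<in> T" "\<forall>s\<in>T. (s, t) \<in> \<sigma>" by auto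
    from t insert.prems ord_total[of x t] consider "(x, t) \<in> \<sigma>" | "(t, x) \<in> \<sigma>" by auto
    then show ?case
    proof cases
      case 2
      with t insert.prems show ?thesis
        by (intro bexI[of _ x]) (auto intro: ord_refl ord_trans)
    qed (use t in auto)
  qed
  from this[of "keys f"] assms obtain t where t: "t \<in> keys f" "\<And>s. s \<in> keys f \<Longrightarrow> (s, t) \<in> \<sigma>"
    by (auto simp: carrier_pring_iff)
  with LT_eqI[OF t] show "LT \<sigma> f \<in> keys f" "\<And>s. s \<in> keys f \<Longrightarrow> (s, LT \<sigma> f) \<in> \<sigma>" by simp_all
qed

lemma LT_mem_pterms: "f \<in> carrier (pring V) \<Longrightarrow> f \<noteq> 0 \<Longrightarrow> LT \<sigma> f \<in> pterms V"
  using LT_props(1) by (auto simp: carrier_pring_iff)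

lemma lead_terms_subset: "J \<subseteq> carrier (pring V) \<Longrightarrow> lead_terms \<sigma> J \<subseteq> pterms V"
  by (auto simp: lead_terms_def intro: LT_mem_pterms)

text \<open>Multiplication by \<open>u\<close> shifts all terms of a polynomial and preserves which
  one is largest.\<close>

lemma lead_terms_add:
  assumes "ideal J (pring V)" "t \<in> lead_terms \<sigma> J" "u \<in> pterms V"
  shows "u + t \<in> lead_terms \<sigma> J"
proof -
  obtain f where f: "f \<in> J" "f \<noteq> 0" "t = LT \<sigma> f"
    using assms(2) by (auto simp: lead_terms_def)
  note fV = pideal_closed(1)[OF assms(1) f(1)]
  note LT = LT_props[OF fV f(2)] LT_mem_pterms[OF fV f(2)]
  have "LT \<sigma> (pmonom u * f) = u + t"
  proof (rule LT_eqI)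
    show "u + t \<in> keys (pmonom u * f)"
      using LT(1) by (simp add: keys_pmonom_mult f(3))
    show "(s, u + t) \<in> \<sigma>" if "s \<in> keys (pmonom u * f)" for s
      using that LT assms(3) fV
      by (auto simp: keys_pmonom_mult f(3) carrier_pring_iff intro!: ord_add_mono ord_refl)
  qed
  moreover have "pmonom u * f \<in> J"
    using assms f by (auto intro: pideal_closed)
  moreover have "pmonom u * f \<noteq> 0"
    using LT(1) keys_pmonom_mult[of u f] by auto
  ultimately show ?thesis
    unfolding lead_terms_def by (metis Diff_iff empty_iff image_eqI insert_iff)
qed

text \<open>Well-founded induction on \<open>t\<close>: a leading term is rewritten by the tail of a
  polynomial that it leads, and the tail terms are smaller. The bound
  \<open>(k, t) \<in> \<sigma>\<close> is carried along because it later controls the terms of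
  \<open>h z\<close>.\<close>

lemma normal_form:
  fixes J :: "'k::field mpol set"
  assumes J: "ideal J (pring V)" and "t \<in> pterms V"
  shows "\<exists>r. r \<in> carrier (pring V) \<and> pmonom t - r \<in> J \<and>
    (\<forall>k\<in>keys r. k \<notin> lead_terms \<sigma> J \<and> (k, t) \<in> \<sigma>)"
  using assms(2)
proof (induction t rule: wf_induct_rule[OF wf_ord])
  case (1 t)
  show ?case
  proof (cases "t \<in> lead_terms \<sigma> J")
    case False
    then show ?thesis
      using 1 by (intro exI[of _ "pmonom t"]) (auto intro: pideal_closed[OF J] ord_refl)
  next
    case True
    then obtain f where f: "f \<in> J" "f \<noteq> 0" "t = LT \<sigma> f"
      by (auto simp: lead_terms_def)
    note fV = pideal_closed(1)[OF J f(1)]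
    note LT = LT_props[OF fV f(2), folded f(3)]
    define S where "S = keys f - {t}"
    define c where "c = inverse (lookup f t)"
    have "\<exists>r. r \<in> carrier (pring V) \<and> pmonom s - r \<in> J \<and>
      (\<forall>k\<in>keys r. k \<notin> lead_terms \<sigma> J \<and> (k, s) \<in> \<sigma>)" if "s \<in> S" for s
      using that LT fV 1 by (intro 1(1)) (auto simp: S_def carrier_pring_iff)
    then obtain r where r: "\<And>s. s \<in> S \<Longrightarrow> r s \<in> carrier (pring V)"
      "\<And>s. s \<in> S \<Longrightarrow> pmonom s - r s \<in> J"
      "\<And>s k. s \<in> S \<Longrightarrow> k \<in> keys (r s) \<Longrightarrow> k \<notin> lead_terms \<sigma> J \<and> (k, s) \<in> \<sigma>"
      by metis
    define a where "a s = pconst (c * lookup f s)" for s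
    \<comment> \<open>\<open>R\<close> is minus the tail of the monic multiple
      \<open>pconst c * f\<close>, with each tail term \<open>s\<close> replaced by its normal form
      \<open>r s\<close>.\<close>
    define R where "R = - (\<Sum>s\<in>S. a s * r s)"
    have "pconst c * f = (\<Sum>s\<in>keys f. a s * pmonom s)"
      by (subst mpol_sum_monomials[of f]) (simp add: sum_distrib_left a_def pconst_mult mult_ac)
    also have "\<dots> = a t * pmonom t + (\<Sum>s\<in>S. a s * pmonom s)"
      unfolding S_def using LT(1) by (intro sum.remove) auto
    also have "a t = 1"
      using LT(1) by (simp add: a_def c_def in_keys_iff)
    finally have "pmonom t - R = pconst c * f - (\<Sum>s\<in>S. a s * (pmonom s - r s))"
      by (simp add: R_def sum_subtractf algebra_simps)
    also have "\<dots> \<in> J"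
      by (intro pideal_closed(5,6)[OF J] pideal_sum_closed[OF J] r f) (simp_all add: a_def)
    finally have "pmonom t - R \<in> J" .
    moreover have "R \<in> carrier (pring V)"
      unfolding R_def by (auto simp: a_def intro!: pring_closed pring_sum_closed r)
    moreover have "k \<notin> lead_terms \<sigma> J \<and> (k, t) \<in> \<sigma>" if k: "k \<in> keys R" for k
    proof -
      obtain s where s: "s \<in> S" "k \<in> keys (r s)"
        using k keys_sum[of "\<lambda>s. a s * r s" S] keys_pconst_mult unfolding R_def a_def keys_minus
        by blast
      then show ?thesis
        using r(3)[OF s] LT(2)[of s] ord_trans by (auto simp: S_def)
    qed
    ultimately show ?thesis by blast
  qed
qed

text \<open>Each minimal leading term minus its normal form. The subtracted terms are no leading
  terms of \<open>J\<close>, so \<open>t\<close> leads \<open>pmonom t - r t\<close> and is the only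
  term in it that another basis element could reduce, which the minimality of \<open>t\<close>
  forbids.\<close>

lemma reduced_groebner_basisI:
  fixes J :: "'k::field mpol set" and r :: "pterm \<Rightarrow> 'k mpol"
  assumes J: "ideal J (pring V)" and T: "T = minimal_terms (lead_terms \<sigma> J)"
    and r: "\<And>t. t \<in> T \<Longrightarrow> pmonom t - r t \<in> J"
      "\<And>t k. t \<in> T \<Longrightarrow> k \<in> keys (r t) \<Longrightarrow> k \<notin> lead_terms \<sigma> J \<and> (k, t) \<in> \<sigma>"
  shows "reduced_groebner_basis V \<sigma> J ((\<lambda>t. pmonom t - r t) ` T)"
proof -
  let ?L = "lead_terms \<sigma> J" and ?g = "\<lambda>t. pmonom t - r t"
  have L: "?L \<subseteq> pterms V"
    using J by (intro lead_terms_subset) (auto intro: pideal_closed)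
  have TL: "T \<subseteq> ?L" by (auto simp: T minimal_terms_def)
  have coeff: "lookup (?g t) t = 1" if "t \<in> T" for t
    using r(2)[of t t] that TL by (auto simp: lookup_minus lookup_pmonom in_keys_iff)
  have keys_g: "s = t \<or> s \<notin> ?L \<and> (s, t) \<in> \<sigma>" if "t \<in> T" "s \<in> keys (?g t)" for s t
    using that r(2)[of t s] keys_diff[of "pmonom t" "r t"] by auto
  have LT: "LT \<sigma> (?g t) = t" if "t \<in> T" for t
    using coeff[OF that] keys_g[OF that] TL L that
    by (intro LT_eqI) (auto simp: in_keys_iff intro: ord_refl)
  have g_J: "?g ` T \<subseteq> J - {0}"
    using r(1) coeff by (auto simp del: right_minus_eq) (metis lookup_zero zero_neq_one)
  have "(\<lambda>g. pmonom (LT \<sigma> g)) ` ?g ` T = (pmonom ` T :: 'k mpol set)"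
    using LT by (force simp: image_image)
  moreover have "Idl\<^bsub>pring V\<^esub> (pmonom ` T) = (Idl\<^bsub>pring V\<^esub> (pmonom ` ?L) :: 'k mpol set)"
  proof -
    have "(\<exists>s\<in>T. term_dvd s t) \<longleftrightarrow> (\<exists>s\<in>?L. term_dvd s t)" for t
    proof
      assume "\<exists>s\<in>?L. term_dvd s t"
      then obtain s u where s: "s \<in> ?L" "t = s + u" by (auto simp: term_dvd_def)
      obtain s' where "s' \<in> T" "term_dvd s' s"
        using minimal_terms_dvd[OF s(1)] T by blast
      then show "\<exists>s\<in>T. term_dvd s t"
        by (intro bexI[of _ s']) (auto simp: term_dvd_def s(2) add.assoc)
    qed (use TL in blast)
    moreover have "T \<subseteq> pterms V" using TL L by simp
    ultimately show ?thesis
      using L by (simp add: Idl_pmonom)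
  qed
  moreover have "\<not> term_dvd (LT \<sigma> g') t"
    if g: "g \<in> ?g ` T" "g' \<in> ?g ` T - {g}" "t \<in> keys g" for g g' t
  proof
    obtain s s' where s: "s \<in> T" "s' \<in> T" "g = ?g s" "g' = ?g s'" "s \<noteq> s'"
      using g by auto
    assume dvd: "term_dvd (LT \<sigma> g') t"
    then obtain u where u: "t = s' + u"
      using LT[OF s(2)] s(4) by (auto simp: term_dvd_def)
    have "keys g \<subseteq> pterms V"
      using g_J g(1) J by (auto simp flip: carrier_pring_iff intro: pideal_closed)
    with g(3) u have "u \<in> pterms V" by auto
    then have "t \<in> ?L"
      using lead_terms_add[OF J, of s' u] s(2) TL by (auto simp: add.commute u)
    with keys_g[of s t] s g(3) have "t = s" by auto
    with s dvd TL LT[OF s(2)] show False by (auto simp: T minimal_terms_def)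
  qed
  ultimately show ?thesis
    unfolding reduced_groebner_basis_def
    using finite_minimal_terms[OF finite_indets L] g_J coeff LT T
    by (auto simp: LT_ideal_eq)
qed

section \<open>Substitutions that do not raise terms\<close>

lemma keys_term_eval:
  assumes "\<And>i k. i \<in> V \<Longrightarrow> k \<in> keys (\<eta> i) \<Longrightarrow> k \<in> pterms V \<and> (k, tvar i) \<in> \<sigma>"
    and "t \<in> pterms V"
  shows "\<forall>k\<in>keys (term_eval \<eta> t). k \<in> pterms V \<and> (k, t) \<in> \<sigma>"
  using assms(2)
proof (induction rule: pterm_induct)
  case zero
  then show ?case by (simp add: ord_refl)
next
  case (tvar_add i t)
  then show ?case
    using keys_mult[of "\<eta> i" "term_eval \<eta> t"] assms(1)[of i]
    by (fastforce simp: term_eval_add intro: ord_add_mono)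
qed

text \<open>If the substitution fixes the leading term, nothing else can contribute to its
  coefficient in the image, so that coefficient survives. This excludes leading terms in K[Y] for
  the kernel of the linear substitution.\<close>

lemma peval_nonzero:
  assumes "\<And>i k. i \<in> V \<Longrightarrow> k \<in> keys (\<eta> i) \<Longrightarrow> k \<in> pterms V \<and> (k, tvar i) \<in> \<sigma>"
    and f: "f \<in> carrier (pring V)" "f \<noteq> 0" and LT: "term_eval \<eta> (LT \<sigma> f) = pmonom (LT \<sigma> f)"
  shows "peval \<eta> f \<noteq> 0"
proof -
  let ?t = "LT \<sigma> f"
  note t = LT_props[OF f]
  \<comment> \<open>The image of \<open>s\<close> has only terms at most \<open>s\<close>, which is
    strictly below \<open>?t\<close>.\<close>
  have "lookup (term_eval \<eta> s) ?t = 0" if s: "s \<in> keys f" "s \<noteq> ?t" for s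
  proof (rule ccontr)
    assume "lookup (term_eval \<eta> s) ?t \<noteq> 0"
    moreover have "s \<in> pterms V" using s(1) f(1) by (auto simp: carrier_pring_iff)
    ultimately have "(?t, s) \<in> \<sigma>"
      using keys_term_eval[of \<eta> s] assms(1) by (auto simp: in_keys_iff)
    with t(2)[OF s(1)] s(2) show False by (blast intro: ord_antisym)
  qed
  then have "lookup (peval \<eta> f) ?t = (\<Sum>s\<in>keys f. if s = ?t then lookup f s else 0)"
    unfolding peval_def lookup_sum by (intro sum.cong) (auto simp: LT lookup_pmonom)
  also have "\<dots> \<noteq> 0"
    using t(1) by (simp add: in_keys_iff)
  finally show ?thesis by auto
qed

end

section \<open>Residue class rings\<close>

lemma pquot_simps:
  fixes J :: "'k::field mpol set"
  assumes "ideal J (pring V)" "p \<in> carrier (pring V)" "q \<in> carrier (pring V)"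
  shows "(J +>\<^bsub>pring V\<^esub> p) \<oplus>\<^bsub>pring V Quot J\<^esub> (J +>\<^bsub>pring V\<^esub> q) = J +>\<^bsub>pring V\<^esub> (p + q)"
    and "(J +>\<^bsub>pring V\<^esub> p) \<otimes>\<^bsub>pring V Quot J\<^esub> (J +>\<^bsub>pring V\<^esub> q) = J +>\<^bsub>pring V\<^esub> (p * q)"
  using ring_hom_add[OF ideal.rcos_ring_hom[OF assms(1)] assms(2,3)]
    ring_hom_mult[OF ideal.rcos_ring_hom[OF assms(1)] assms(2,3)] by simp_all

lemma pquot_one: "\<one>\<^bsub>pring V Quot J\<^esub> = J +>\<^bsub>pring V\<^esub> 1"
  by (simp add: FactRing_def)

lemma pquot_carrier: "p \<in> carrier (pring V) \<Longrightarrow> J +>\<^bsub>pring V\<^esub> p \<in> carrier (pring V Quot J)"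
  by (simp add: carrier_Quot)

text \<open>Primes of \<open>S\<close> pull back to primes of \<open>R\<close>, and surjectivity
  keeps the inclusions of a chain strict.\<close>

lemma krull_dim_le_surj:
  assumes h: "h \<in> ring_hom R S" "h ` carrier R = carrier S" and "cring R" "cring S"
  shows "krull_dim S \<le> krull_dim R"
  unfolding krull_dim_def
proof (rule Sup_subset_mono, safe)
  interpret R: cring R by fact
  interpret S: cring S by fact
  interpret ring_hom_ring R S h
    using h(1) by (intro ring_hom_ringI2) unfold_locales
  fix k :: nat and p :: "nat \<Rightarrow> _"
  assume p: "\<forall>i\<le>k. primeideal (p i) S" "\<forall>i<k. p i \<subset> p (Suc i)"
  let ?q = "\<lambda>i. {x \<in> carrier R. h x \<in> p i}"
  have "primeideal (?q i) R" if "i \<le> k" for i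
    using p(1) that by (intro primeideal_vimage) (auto intro: assms(3))
  moreover have "?q i \<subset> ?q (Suc i)" if "i < k" for i
  proof -
    from p(2) that obtain y where y: "y \<in> p (Suc i)" "y \<notin> p i" and sub: "p i \<subseteq> p (Suc i)"
      by blast
    have "ideal (p (Suc i)) S"
      using p(1) that by (auto intro: primeideal.axioms(1))
    then have "y \<in> carrier S" using y(1) by (rule ideal.Icarr)
    with h(2) obtain x where "x \<in> carrier R" "y = h x" by blast
    with y sub show ?thesis by auto
  qed
  ultimately show "\<exists>k'. enat k = enat k' \<and>
      (\<exists>q. (\<forall>i\<le>k'. primeideal (q i) R) \<and> (\<forall>i<k'. q i \<subset> q (Suc i)))"
    by (intro exI[of _ k] conjI refl exI[of _ ?q]) auto
qed

text \<open>For \<open>card Y \<le> card W\<close>, \<open>K[Y]\<close> is a quotient of \<open>K[W]\<close>; this makes it unnecessary to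
  know the Krull dimension of a polynomial ring.\<close>

lemma krull_dim_pring_mono:
  assumes "finite Y" "finite W" "card Y \<le> card W"
  shows "krull_dim (pring Y :: 'k::field mpol ring) \<le> krull_dim (pring W :: 'k mpol ring)"
proof -
  obtain g where g: "g ` Y \<subseteq> W" "inj_on g Y"
    using card_le_inj[OF assms] by blast
  \<comment> \<open>Undoes the renaming \<open>g\<close> on its image and sends the remaining
    indeterminates to 0; a preimage of \<open>q\<close> is then \<open>q\<close> renamed by
    \<open>g\<close>.\<close>
  define \<eta> :: "nat \<Rightarrow> 'k mpol" where "\<eta> w = (if w \<in> g ` Y then pvar (inv_into Y g w) else 0)" for w
  have \<eta>: "\<eta> w \<in> carrier (pring Y)" for w
    by (auto simp: \<eta>_def inv_into_into)
  have "q \<in> peval \<eta> ` carrier (pring W)" if q: "q \<in> carrier (pring Y)" for q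
  proof
    show "peval (\<lambda>y. pvar (g y)) q \<in> carrier (pring W)"
      using q g(1) by (auto intro!: peval_closed)
    show "q = peval \<eta> (peval (\<lambda>y. pvar (g y)) q)"
      using q by (induction rule: pring_induct)
        (auto simp: peval_add peval_mult \<eta>_def inv_into_f_f[OF g(2)])
  qed
  then have "peval \<eta> ` carrier (pring W) = carrier (pring Y)"
    using \<eta> by (auto intro: peval_closed)
  then show ?thesis
    using \<eta> by (intro krull_dim_le_surj[OF peval_ring_hom _ pring_cring pring_cring])
qed

section \<open>Linear parts\<close>

lemma term_degree_eq_zero_iff [simp]: "term_degree t = 0 \<longleftrightarrow> t = 0"
proof
  assume "term_degree t = 0"
  then have "\<forall>i\<in>keys t. lookup t i = 0" by (simp add: term_degree_def)
  then have "keys t = {}" by (auto simp del: keys_eq_empty simp: in_keys_iff)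
  then show "t = 0" by simp
qed simp

lemma pterm_cases:
  assumes "t \<in> pterms V" "t \<noteq> 0"
  obtains i u where "i \<in> V" "u \<in> pterms V" "t = tvar i + u"
proof -
  have "t \<noteq> 0 \<longrightarrow> (\<exists>i\<in>V. \<exists>u\<in>pterms V. t = tvar i + u)"
    using assms(1) by (induction rule: pterm_induct) auto
  with assms(2) that show thesis by blast
qed

lemma term_degree_eq_one_iff:
  assumes "t \<in> pterms V"
  shows "term_degree t = 1 \<longleftrightarrow> (\<exists>i\<in>V. t = tvar i)"
proof
  assume "term_degree t = 1"
  then have "t \<noteq> 0" by auto
  from pterm_cases[OF assms this] obtain i u where "i \<in> V" "t = tvar i + u" by blast
  with \<open>term_degree t = 1\<close> show "\<exists>i\<in>V. t = tvar i"
    by (auto simp: term_degree_add)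
qed auto

lemma lookup_lin: "lookup (lin f) t = (if term_degree t = 1 then lookup f t else 0)"
  by (cases "lookup f t = 0") (simp_all add: lin_def hom_component_def lookup_mapp when_def in_keys_iff)

lemma keys_lin: "keys (lin f) \<subseteq> keys f"
  by (auto simp: in_keys_iff lookup_lin split: if_splits)

lemma lin_closed [simp]: "f \<in> carrier (pring V) \<Longrightarrow> lin f \<in> carrier (pring V)"
  using keys_lin by (auto simp: carrier_pring_iff)

lemma lin_simps [simp]:
  "lin 0 = 0" "lin (f + g) = lin f + lin g" "lin (f - g) = lin f - lin g"
  "lin (pconst c * f) = pconst c * lin f" "lin (pvar i) = pvar i" "lin (lin f) = lin f"
  "lin (pconst c) = 0" "lookup (lin f) (tvar i) = lookup f (tvar i)"
  by (auto intro!: poly_mapping_eqI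
      simp: lookup_lin lookup_add lookup_minus lookup_pvar lookup_pconst)

lemma lin_sum: "lin (sum f A) = (\<Sum>x\<in>A. lin (f x))"
  by (induction A rule: infinite_finite_induct) simp_all

lemma linear_form_eq:
  assumes "finite V" "f \<in> carrier (pring V)" "lin f = f"
  shows "f = (\<Sum>i\<in>V. pconst (lookup f (tvar i)) * pvar i)"
proof (rule poly_mapping_eqI)
  fix t
  show "lookup f t = lookup (\<Sum>i\<in>V. pconst (lookup f (tvar i)) * pvar i) t"
  proof (cases "\<exists>i\<in>V. t = tvar i")
    case True
    with assms(1) show ?thesis
      by (auto simp: lookup_sum lookup_pvar if_distrib[of "(*) _"] cong: if_cong)
  next
    case False
    have "lookup f t = lookup (lin f) t" by (simp add: assms(3))
    also have "\<dots> = 0"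
      using False assms(2) term_degree_eq_one_iff[of t V]
      by (auto simp: lookup_lin carrier_pring_iff in_keys_iff subset_iff)
    finally show ?thesis
      using False by (auto simp: lookup_sum lookup_pvar intro!: sum.neutral[symmetric])
  qed
qed

text \<open>An indeterminate factors only as 1 times itself, in two orders, which gives the two
  summands.\<close>

lemma lookup_tvar_mult:
  fixes f g :: "'k::field mpol"
  shows "lookup (f * g) (tvar i) = lookup f 0 * lookup g (tvar i) + lookup g 0 * lookup f (tvar i)"
proof (induction f rule: pring_linear_induct[OF carrier_pring_UNIV, case_names pmonom add])
  case (pmonom c s)
  show ?case
  proof (induction g rule: pring_linear_induct[OF carrier_pring_UNIV, case_names pmonom add])
    case (pmonom d t)
    have eq: "(pconst c * pmonom s) * (pconst d * pmonom t) = pconst (c * d) * pmonom (s + t)"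
      by (simp add: pconst_mult pmonom_add mult_ac)
    have "s + t = tvar i \<longleftrightarrow> s = 0 \<and> t = tvar i \<or> s = tvar i \<and> t = 0"
    proof
      assume st: "s + t = tvar i"
      then have "term_degree s + term_degree t = 1"
        by (simp flip: term_degree_add)
      then have "term_degree s = 0 \<or> term_degree t = 0" by linarith
      with st show "s = 0 \<and> t = tvar i \<or> s = tvar i \<and> t = 0" by auto
    qed auto
    then show ?case
      unfolding eq by (auto simp: lookup_pmonom)
  qed (simp add: lookup_add algebra_simps)
qed (simp add: lookup_add algebra_simps)

text \<open>The product rule at the origin, with \<open>lookup f 0\<close> in the role of
  f(0).\<close>

lemma lin_mult: "lin (f * g) = pconst (lookup f 0) * lin g + pconst (lookup g 0) * lin f"
proof (rule poly_mapping_eqI)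
  fix t
  show "lookup (lin (f * g)) t = lookup (pconst (lookup f 0) * lin g + pconst (lookup g 0) * lin f) t"
    using term_degree_eq_one_iff[of t UNIV]
    by (auto simp: lookup_lin lookup_add lookup_tvar_mult pterms_def)
qed

section \<open>Spans\<close>

text \<open>Used to carry a linear condition, such as a vanishing coefficient or a vanishing image,
  from generators to their span.\<close>

lemma (in ring) Span_subsetI:
  assumes "set us \<subseteq> E" "\<zero> \<in> E" "\<And>x y. x \<in> E \<Longrightarrow> y \<in> E \<Longrightarrow> x \<oplus> y \<in> E"
    and "\<And>k x. k \<in> K \<Longrightarrow> x \<in> E \<Longrightarrow> k \<otimes> x \<in> E"
  shows "Span K us \<subseteq> E"
  using assms(1)
proof (induction us)
  case (Cons u us)
  then show ?case
    by (auto simp: line_extension_mem_iff intro!: assms(3,4))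
qed (simp add: assms(2))

lemma pconst_subfield: "subfield (range pconst) (pring V :: 'k::field mpol ring)"
proof -
  interpret cring "pring V :: 'k mpol ring" by (rule pring_cring)
  have "subring (range pconst) (pring V :: 'k mpol ring)"
  proof (rule subringI)
    show "\<one>\<^bsub>pring V\<^esub> \<in> range (pconst :: 'k \<Rightarrow> _)"
      by (auto intro: range_eqI[of _ _ 1])
  qed (auto simp flip: pconst_uminus pconst_mult pconst_add)
  then have sub: "subcring (range pconst) (pring V :: 'k mpol ring)"
    by (rule subcringI') 
  show ?thesis
  proof (rule subfieldI[OF sub])
    show "Units (pring V \<lparr>carrier := range pconst\<rparr>) = range pconst - {\<zero>\<^bsub>pring V :: 'k mpol ring\<^esub>}"
    proof
      show "Units (pring V \<lparr>carrier := range pconst\<rparr>) \<subseteq> range pconst - {\<zero>\<^bsub>pring V :: 'k mpol ring\<^esub>}"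
        by (auto simp: Units_def)
      show "range pconst - {\<zero>\<^bsub>pring V :: 'k mpol ring\<^esub>} \<subseteq> Units (pring V \<lparr>carrier := range pconst\<rparr>)"
      proof
        fix p :: "'k mpol" assume "p \<in> range pconst - {\<zero>\<^bsub>pring V\<^esub>}"
        then obtain c where c: "p = pconst c" "c \<noteq> 0"
          using pconst_simps(1) by force
        then have "pconst (inverse c) * p = 1" "p * pconst (inverse c) = 1"
          using pconst_mult_inverse[OF c(2)] by (simp_all add: mult.commute)
        with c(1) show "p \<in> Units (pring V \<lparr>carrier := range pconst\<rparr>)"
          by (auto simp: Units_def)
      qed
    qed
  qed
qed

lemma lin_mem_Lin:
  assumes "f \<in> J" "f \<in> carrier (pring V)"
  shows "lin f \<in> Lin V J"
proof -
  interpret ring "pring V :: 'a mpol ring" by (rule pring_ring)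
  have "lin f \<in> Span (range pconst) [lin f]"
    using Span_base_incl[OF pconst_subfield, of "[lin f]"] assms(2) by simp
  then show ?thesis
    unfolding Lin_def using assms(1) by (auto intro!: exI[of _ "[lin f]"])
qed

section \<open>The separating re-embedding\<close>

locale separated_ideal =
  fixes X :: "nat set" and I :: "'k::field mpol set" and zs :: "nat list" and \<sigma> :: "pterm rel"
  assumes finite_X: "finite X" and ideal_I: "ideal I (pring X)" and I_origin: "I \<subseteq> origin_ideal X"
    and distinct_zs: "distinct zs" and zs_X: "set zs \<subseteq> X"
    and separating: "separating_ordering X zs I \<sigma>"
begin

definition Y :: "nat set"
  where "Y = X - set zs"

definition J :: "'k mpol set"
  where "J = I \<inter> carrier (pring Y)"

sublocale term_order X \<sigma>
  using finite_X separating by unfold_locales (simp_all add: separating_ordering_def)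

lemma Y_X: "Y \<subseteq> X" and finite_Y: "finite Y"
  using finite_X by (auto simp: Y_def)

lemma Y_pring [simp]: "p \<in> carrier (pring Y) \<Longrightarrow> p \<in> carrier (pring X)"
  using Y_X by (rule pring_mono)

lemma ideal_J: "ideal J (pring Y)"
  unfolding J_def using ideal_I by (intro pidealI) (auto intro: pideal_closed)

lemma lookup_I_zero: "f \<in> I \<Longrightarrow> lookup f 0 = 0"
  using I_origin by (auto simp: origin_ideal_iff)

lemma lead_terms_I: "lead_terms \<sigma> I \<subseteq> pterms X"
  by (intro lead_terms_subset) (auto intro: pideal_closed[OF ideal_I])

lemma tvar_lead_term: "z \<in> set zs \<Longrightarrow> tvar z \<in> lead_terms \<sigma> I"
  using separating
  by (auto simp: separating_ordering_def lead_terms_def in_set_conv_nth)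
    (metis Diff_iff empty_iff image_eqI insert_iff)

text \<open>Elements of \<open>I\<close> have no constant term. Consequently 1 cannot compete with
  the indeterminates \<open>z\<close> as a minimal leading term.\<close>

lemma zero_not_lead_term: "0 \<notin> lead_terms \<sigma> I"
proof
  assume "0 \<in> lead_terms \<sigma> I"
  then obtain f where "0 = LT \<sigma> f" "f \<in> I - {0}"
    unfolding lead_terms_def by (rule imageE)
  then have f: "f \<in> I" "f \<noteq> 0" "LT \<sigma> f = 0" by simp_all
  have "LT \<sigma> f \<in> keys f"
    by (intro LT_props(1) pideal_closed(1)[OF ideal_I] f)
  with lookup_I_zero[OF f(1)] f(3) show False
    by (simp add: in_keys_iff)
qed

lemma pterms_Y_cases:
  assumes "t \<in> pterms X"
  obtains "t \<in> pterms Y" | z u where "z \<in> set zs" "u \<in> pterms X" "t = tvar z + u"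
proof (cases "t \<in> pterms Y")
  case False
  then obtain z where z: "z \<in> keys t" "z \<in> set zs"
    using assms by (auto simp: pterms_def Y_def)
  have t: "t = tvar z + (t - tvar z)"
    using z(1) by (intro poly_mapping_eqI)
      (auto simp: lookup_add lookup_minus tvar_def lookup_single in_keys_iff when_def)
  have "t - tvar z \<in> pterms X"
    using assms unfolding t[symmetric] by (subst (asm) t) simp
  with z(2) t that(2) show thesis by blast
qed

text \<open>A term involving some \<open>z\<close> is a multiple of the leading term
  \<open>z\<close>. Hence normal forms modulo \<open>I\<close> lie in K[Y].\<close>

lemma not_lead_term_imp_Y:
  assumes "t \<in> pterms X" "t \<notin> lead_terms \<sigma> I"
  shows "t \<in> pterms Y"
  using assms(1)
proof (cases rule: pterms_Y_cases)
  case (2 z u)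
  with lead_terms_add[OF ideal_I tvar_lead_term, of z u] assms(2) show ?thesis
    by (simp add: add.commute)
qed

text \<open>Yields the shape of the reduced Groebner basis: a minimal leading term is one of the
  \<open>z\<close> or free of all of them, since a proper multiple of \<open>z\<close> is not
  minimal.\<close>

lemma minimal_lead_terms:
  "t \<in> minimal_terms (lead_terms \<sigma> I) \<longleftrightarrow>
    t \<in> tvar ` set zs \<or> t \<in> minimal_terms (lead_terms \<sigma> I) \<inter> pterms Y"
proof -
  have "tvar z \<in> minimal_terms (lead_terms \<sigma> I)" if "z \<in> set zs" for z
  proof -
    have "s = tvar z" if s: "s \<in> lead_terms \<sigma> I" "tvar z = s + u" for s u
    proof -
      have "term_degree s + term_degree u = 1"
        by (simp flip: term_degree_add s(2))
      moreover have "s \<noteq> 0"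
        using s(1) zero_not_lead_term by blast
      ultimately have "term_degree u = 0"
        using term_degree_eq_zero_iff[of s] by linarith
      with s(2) show ?thesis by simp
    qed
    then show ?thesis
      using tvar_lead_term[OF that] by (auto simp: minimal_terms_def term_dvd_def)
  qed
  moreover have "t \<in> tvar ` set zs \<union> pterms Y" if t: "t \<in> minimal_terms (lead_terms \<sigma> I)"
  proof -
    have "t \<in> pterms X"
      using t lead_terms_I by (auto simp: minimal_terms_def)
    then show ?thesis
    proof (cases rule: pterms_Y_cases)
      case (2 z u)
      then have "tvar z = t"
        using t tvar_lead_term[of z] by (auto simp: minimal_terms_def term_dvd_def)
      with \<open>z \<in> set zs\<close> show ?thesis by (metis UnI1 imageI)
    qed simp
  qed
  ultimately show ?thesis by blast
qed

text \<open>Involves no choice of a Groebner basis; \<open>restrict\<close> matches the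
  \<open>extensional\<close> condition in the definition of the re-embedding.\<close>

definition restr :: "'k mpol set \<Rightarrow> 'k mpol set"
  where "restr = restrict (\<lambda>C. C \<inter> carrier (pring Y)) (carrier (pring X Quot I))"

lemma restr_coset:
  assumes "r \<in> carrier (pring Y)"
  shows "restr (I +>\<^bsub>pring X\<^esub> r) = J +>\<^bsub>pring Y\<^esub> r"
proof -
  have "x - r \<in> I \<and> x \<in> carrier (pring Y) \<longleftrightarrow> x - r \<in> J" for x
    using assms pring_closed(5)[of "x - r" Y r] by (auto simp: J_def)
  then have "(I +>\<^bsub>pring X\<^esub> r) \<inter> carrier (pring Y) = J +>\<^bsub>pring Y\<^esub> r"
    unfolding set_eq_iff Int_iff pideal_coset_mem_iff by blast
  then show ?thesis
    using assms by (simp add: restr_def pquot_carrier)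
qed

end

text \<open>A reduced Groebner basis in separated form, with \<open>h\<close> indexed by the
  indeterminate instead of its position in the tuple. \<open>h_ord\<close> records the bound on
  terms inherited from the normal forms.\<close>

locale coordinate_forms = separated_ideal X I zs \<sigma>
  for X and I :: "'k::field mpol set" and zs \<sigma> +
  fixes h :: "nat \<Rightarrow> 'k mpol" and G' :: "'k mpol set"
  assumes h_Y: "\<And>z. z \<in> set zs \<Longrightarrow> h z \<in> carrier (pring Y)"
    and h_I: "\<And>z. z \<in> set zs \<Longrightarrow> pvar z - h z \<in> I"
    and h_ord: "\<And>z k. z \<in> set zs \<Longrightarrow> k \<in> keys (h z) \<Longrightarrow> (k, tvar z) \<in> \<sigma>"
    and G'_Y: "G' \<subseteq> carrier (pring Y)"
    and reduced: "reduced_groebner_basis X \<sigma> I ((\<lambda>z. pvar z - h z) ` set zs \<union> G')"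

text \<open>\<open>h z\<close> is the normal form of \<open>z\<close>, and \<open>G'\<close>
  consists of the basis elements whose leading terms lie in K[Y]; their tails are normal forms and
  lie there too.\<close>

lemma (in separated_ideal) ex_coordinate_forms:
  obtains h G' where "coordinate_forms X I zs \<sigma> h G'"
proof -
  let ?L = "lead_terms \<sigma> I"
  have "\<exists>r. \<forall>t\<in>pterms X. r t \<in> carrier (pring X) \<and> pmonom t - r t \<in> I \<and>
      (\<forall>k\<in>keys (r t). k \<notin> ?L \<and> (k, t) \<in> \<sigma>)"
    by (intro bchoice ballI normal_form[OF ideal_I])
  then obtain r :: "pterm \<Rightarrow> 'k mpol" where r: "\<And>t. t \<in> pterms X \<Longrightarrow> r t \<in> carrier (pring X)"
    "\<And>t. t \<in> pterms X \<Longrightarrow> pmonom t - r t \<in> I"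
    "\<And>t k. t \<in> pterms X \<Longrightarrow> k \<in> keys (r t) \<Longrightarrow> k \<notin> ?L \<and> (k, t) \<in> \<sigma>"
    by blast
  have rY: "r t \<in> carrier (pring Y)" if "t \<in> pterms X" for t
    using r(1,3)[OF that] not_lead_term_imp_Y by (auto simp: carrier_pring_iff)
  have zX: "tvar z \<in> pterms X" if "z \<in> set zs" for z
    using that zs_X by auto
  let ?T = "minimal_terms ?L"
  let ?G' = "(\<lambda>t. pmonom t - r t) ` (?T \<inter> pterms Y)"
  have TX: "?T \<subseteq> pterms X"
    using lead_terms_I by (auto simp: minimal_terms_def)
  have "reduced_groebner_basis X \<sigma> I ((\<lambda>t. pmonom t - r t) ` ?T)"
    using TX r by (intro reduced_groebner_basisI[OF ideal_I refl]) blast+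
  also have "?T = tvar ` set zs \<union> ?T \<inter> pterms Y"
    using minimal_lead_terms by blast
  also have "(\<lambda>t. pmonom t - r t) ` \<dots> = (\<lambda>z. pvar z - r (tvar z)) ` set zs \<union> ?G'"
    by (simp add: image_Un image_image pvar_def)
  finally have G: "reduced_groebner_basis X \<sigma> I \<dots>" .
  have "coordinate_forms X I zs \<sigma> (\<lambda>z. r (tvar z)) ?G'"
  proof (unfold_locales, goal_cases)
    case 4
    show ?case using TX rY by auto
  qed (use rY r(2,3) zX G in \<open>auto simp: pvar_def\<close>)
  with that show thesis .
qed

context coordinate_forms
begin

lemma zs_pvar [simp]: "z \<in> set zs \<Longrightarrow> pvar z \<in> carrier (pring X)"
  using zs_X by auto

text \<open>The sum of K[Y] and \<open>I\<close> is a subring that contains each \<open>z\<close>,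
  because \<open>pvar z - h z\<close> is in \<open>I\<close>.\<close>

lemma ex_representative:
  assumes "f \<in> carrier (pring X)"
  obtains r where "r \<in> carrier (pring Y)" "I +>\<^bsub>pring X\<^esub> f = I +>\<^bsub>pring X\<^esub> r"
proof -
  have "\<exists>r\<in>carrier (pring Y). f - r \<in> I"
    using assms
  proof (induction rule: pring_induct)
    case (pconst c)
    then show ?case by (intro bexI[of _ "pconst c"]) (auto intro: pideal_closed[OF ideal_I])
  next
    case (pvar i)
    then show ?case
    proof (cases "i \<in> set zs")
      case False
      with pvar show ?thesis
        by (intro bexI[of _ "pvar i"]) (auto simp: Y_def intro: pideal_closed[OF ideal_I])
    qed (use h_Y h_I in blast)
  next
    case (add f g)
    then obtain r s where "r \<in> carrier (pring Y)" "s \<in> carrier (pring Y)" "f - r \<in> I" "g - s \<in> I"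
      by blast
    moreover from this have "(f + g) - (r + s) \<in> I"
      using pideal_closed(3)[OF ideal_I, of "f - r" "g - s"] by (simp add: algebra_simps)
    ultimately show ?case by (intro bexI[of _ "r + s"]) auto
  next
    case (mult f g)
    then obtain r s where rs: "r \<in> carrier (pring Y)" "s \<in> carrier (pring Y)" "f - r \<in> I" "g - s \<in> I"
      by blast
    have "f * g - r * s = (f - r) * g + r * (g - s)"
      by (simp add: algebra_simps)
    also have "\<dots> \<in> I"
      using rs mult.hyps by (intro pideal_closed(3,6,7)[OF ideal_I]) auto
    finally show ?case
      using rs by (intro bexI[of _ "r * s"]) auto
  qed
  then show thesis
    using that pideal_coset_eq_iff[OF ideal_I assms] by auto
qed

text \<open>With representatives chosen in K[Y], \<open>restr\<close> sends the class of
  \<open>r\<close> to the class of \<open>r\<close>; it is injective because \<open>J\<close> is the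
  full intersection of \<open>I\<close> with K[Y].\<close>

lemma restr_alg_iso: "restr \<in> alg_iso X I Y J"
proof -
  have carr: "carrier (pring X Quot I) = (\<lambda>r. I +>\<^bsub>pring X\<^esub> r) ` carrier (pring Y)"
  proof
    show "carrier (pring X Quot I) \<subseteq> (\<lambda>r. I +>\<^bsub>pring X\<^esub> r) ` carrier (pring Y)"
      unfolding carrier_Quot by (auto elim: ex_representative)
  qed (auto simp: pquot_carrier)
  have hom: "restr \<in> ring_hom (pring X Quot I) (pring Y Quot J)"
    by (rule ring_hom_memI)
      (auto simp: carr restr_coset pquot_carrier pquot_simps[OF ideal_I] pquot_simps[OF ideal_J] pquot_one)
  have "inj_on restr (carrier (pring X Quot I))"
  proof (rule inj_onI, unfold carr, elim imageE, hypsubst)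
    fix r s assume rs: "r \<in> carrier (pring Y)" "s \<in> carrier (pring Y)"
      and "restr (I +>\<^bsub>pring X\<^esub> r) = restr (I +>\<^bsub>pring X\<^esub> s)"
    then have "r - s \<in> I"
      using pideal_coset_eq_iff[OF ideal_J] by (simp add: restr_coset J_def)
    with rs show "I +>\<^bsub>pring X\<^esub> r = I +>\<^bsub>pring X\<^esub> s"
      by (simp add: pideal_coset_eq_iff[OF ideal_I])
  qed
  moreover have "restr ` carrier (pring X Quot I) = carrier (pring Y Quot J)"
    unfolding carr image_image carrier_Quot[of "pring Y"] by (simp add: restr_coset)
  ultimately show ?thesis
    using hom by (auto simp: alg_iso_def alg_hom_def ring_iso_def bij_betw_def restr_coset)
qed

text \<open>The description quantifies over \<open>G\<close> and \<open>h\<close>, so two candidates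
  may come with different data. Whatever \<open>h'\<close> is, \<open>z - h'\<close> lies in
  \<open>I\<close>, so both sides agree on the classes of all indeterminates and hence
  everywhere.\<close>

lemma separating_re_embedding_eq: "separating_re_embedding X zs \<sigma> I = restr"
  unfolding separating_re_embedding_def Let_def Y_def[symmetric] J_def[symmetric]
proof (rule the_equality)
  let ?G = "(\<lambda>z. pvar z - h z) ` set zs \<union> G'"
  have "restr (I +>\<^bsub>pring X\<^esub> pvar z) = J +>\<^bsub>pring Y\<^esub> h z" if z: "z \<in> set zs" for z
  proof -
    have "I +>\<^bsub>pring X\<^esub> pvar z = I +>\<^bsub>pring X\<^esub> h z"
      using z h_I h_Y by (simp add: pideal_coset_eq_iff[OF ideal_I])
    then show ?thesis by (simp add: restr_coset h_Y z)
  qed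
  moreover have "?G = {pvar (zs ! j) - h (zs ! j) | j. j < length zs} \<union> G'"
    by (auto simp: set_conv_nth)
  ultimately show "\<exists>G G' h. reduced_groebner_basis X \<sigma> I G \<and>
      G = {pvar (zs ! j) - h j | j. j < length zs} \<union> G' \<and> G' \<subseteq> carrier (pring Y) \<and>
      (\<forall>j<length zs. h j \<in> carrier (pring Y)) \<and> restr \<in> alg_hom X I Y J \<and>
      restr \<in> extensional (carrier (pring X Quot I)) \<and>
      (\<forall>i\<in>Y. restr (I +>\<^bsub>pring X\<^esub> pvar i) = J +>\<^bsub>pring Y\<^esub> pvar i) \<and>
      (\<forall>j<length zs. restr (I +>\<^bsub>pring X\<^esub> pvar (zs ! j)) = J +>\<^bsub>pring Y\<^esub> h j)"
    using reduced G'_Y h_Y restr_alg_iso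
    by (intro exI[of _ ?G] exI[of _ G'] exI[of _ "\<lambda>j. h (zs ! j)"])
      (auto simp: restr_coset alg_iso_def, simp add: restr_def)
next
  fix \<Phi>
  assume "\<exists>G G' h. reduced_groebner_basis X \<sigma> I G \<and>
      G = {pvar (zs ! j) - h j | j. j < length zs} \<union> G' \<and> G' \<subseteq> carrier (pring Y) \<and>
      (\<forall>j<length zs. h j \<in> carrier (pring Y)) \<and> \<Phi> \<in> alg_hom X I Y J \<and>
      \<Phi> \<in> extensional (carrier (pring X Quot I)) \<and>
      (\<forall>i\<in>Y. \<Phi> (I +>\<^bsub>pring X\<^esub> pvar i) = J +>\<^bsub>pring Y\<^esub> pvar i) \<and>
      (\<forall>j<length zs. \<Phi> (I +>\<^bsub>pring X\<^esub> pvar (zs ! j)) = J +>\<^bsub>pring Y\<^esub> h j)"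
  then obtain G G'' h' where "reduced_groebner_basis X \<sigma> I G"
      and G: "G = {pvar (zs ! j) - h' j | j. j < length zs} \<union> G''"
      and h': "\<forall>j<length zs. h' j \<in> carrier (pring Y)"
      and \<Phi>: "\<Phi> \<in> alg_hom X I Y J" "\<Phi> \<in> extensional (carrier (pring X Quot I))"
      "\<forall>i\<in>Y. \<Phi> (I +>\<^bsub>pring X\<^esub> pvar i) = J +>\<^bsub>pring Y\<^esub> pvar i"
      "\<forall>j<length zs. \<Phi> (I +>\<^bsub>pring X\<^esub> pvar (zs ! j)) = J +>\<^bsub>pring Y\<^esub> h' j"
    by blast
  then have GI: "G \<subseteq> I" by (auto simp: reduced_groebner_basis_def)
  have hom: "\<Phi> \<in> ring_hom (pring X Quot I) (pring Y Quot J)"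
      "restr \<in> ring_hom (pring X Quot I) (pring Y Quot J)"
    using \<Phi>(1) restr_alg_iso by (simp_all add: alg_hom_def alg_iso_def)
  have "\<Phi> (I +>\<^bsub>pring X\<^esub> f) = restr (I +>\<^bsub>pring X\<^esub> f)" if "f \<in> carrier (pring X)" for f
    using that
  proof (induction rule: pring_induct)
    case (pconst c)
    then show ?case using \<Phi>(1) by (simp add: alg_hom_def restr_coset)
  next
    case (pvar i)
    show ?case
    proof (cases "i \<in> Y")
      case False
      with pvar obtain j where j: "j < length zs" "i = zs ! j"
        by (auto simp: Y_def in_set_conv_nth)
      then have "pvar i - h' j \<in> I" using GI G by blast
      then have "I +>\<^bsub>pring X\<^esub> pvar i = I +>\<^bsub>pring X\<^esub> h' j"
        using pvar h' j by (simp add: pideal_coset_eq_iff[OF ideal_I])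
      with \<Phi>(4) h' j show ?thesis by (metis restr_coset)
    qed (simp add: \<Phi>(3) restr_coset)
  next
    case (add f g)
    then show ?case
      by (simp add: pquot_simps(1)[OF ideal_I, symmetric] ring_hom_add[OF hom(1)] ring_hom_add[OF hom(2)]
          pquot_carrier)
  next
    case (mult f g)
    then show ?case
      by (simp add: pquot_simps(2)[OF ideal_I, symmetric] ring_hom_mult[OF hom(1)] ring_hom_mult[OF hom(2)]
          pquot_carrier)
  qed
  then have "\<Phi> C = restr C" if "C \<in> carrier (pring X Quot I)" for C
    using that by (auto simp: carrier_Quot)
  then show "\<Phi> = restr"
    using \<Phi>(2) by (intro extensionalityI[of _ "carrier (pring X Quot I)"]) (simp_all add: restr_def)
qed

lemma restr_re_embedding: "re_embedding X I Y J restr"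
  using finite_Y ideal_J restr_alg_iso by (simp add: re_embedding_def)

end

section \<open>Optimality and the cotangent space\<close>

lemma ideal_origin_ideal: "ideal (origin_ideal V :: 'k::field mpol set) (pring V)"
  unfolding origin_ideal_def by (rule ring.genideal_ideal[OF pring_ring]) auto

locale full_linear_part = coordinate_forms X I zs \<sigma> h G'
  for X and I :: "'k::field mpol set" and zs \<sigma> h G' +
  assumes dim: "ring.dimension (pring X) (length zs) (range pconst) (Lin X I)"
begin

section \<open>The linear substitution and the derivation at the origin\<close>

definition \<rho> :: "nat \<Rightarrow> 'k mpol"
  where "\<rho> i = (if i \<in> set zs then lin (h i) else pvar i)"

text \<open>The linear form in \<open>K[Y]\<close> that is congruent to \<open>lin f\<close> modulo \<open>Lin(I)\<close>. As a function
  of \<open>f\<close>, it is a derivation at the origin that vanishes on \<open>I\<close>.\<close>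

definition D :: "'k mpol \<Rightarrow> 'k mpol"
  where "D f = peval \<rho> (lin f)"

lemma \<rho>_simps: "i \<in> Y \<Longrightarrow> \<rho> i = pvar i" "z \<in> set zs \<Longrightarrow> \<rho> z = lin (h z)"
  by (auto simp: \<rho>_def Y_def)

lemma \<rho>_Y: "i \<in> X \<Longrightarrow> \<rho> i \<in> carrier (pring Y)"
  by (cases "i \<in> set zs") (simp_all add: \<rho>_simps h_Y, simp add: \<rho>_def Y_def)

lemma peval_\<rho>_Y: "p \<in> carrier (pring Y) \<Longrightarrow> peval \<rho> p = p"
  by (rule peval_id[of _ Y]) (simp_all add: \<rho>_simps)

lemma D_Y: "f \<in> carrier (pring X) \<Longrightarrow> D f \<in> carrier (pring Y)"
  unfolding D_def by (rule peval_closed[of _ X]) (auto simp: \<rho>_Y)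

lemma D_simps [simp]:
  "D (f + g) = D f + D g" "D (f - g) = D f - D g" "D (pconst c * f) = pconst c * D f"
  "D (pconst c) = 0"
  by (simp_all add: D_def peval_add peval_diff peval_mult)

lemma D_pvar [simp]: "y \<in> Y \<Longrightarrow> D (pvar y) = pvar y"
  by (simp add: D_def \<rho>_simps)

lemma D_mult: "D (f * g) = pconst (lookup f 0) * D g + pconst (lookup g 0) * D f"
  by (simp add: D_def lin_mult peval_add peval_mult)

lemma linear_form_X: "f \<in> carrier (pring X) \<Longrightarrow>
    lin f = (\<Sum>i\<in>X. pconst (lookup f (tvar i)) * pvar i)"
  using linear_form_eq[OF finite_X, of "lin f"] by simp

lemma D_eq_sum: "f \<in> carrier (pring X) \<Longrightarrow> D f = (\<Sum>i\<in>X. pconst (lookup f (tvar i)) * \<rho> i)"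
  by (simp add: D_def linear_form_X peval_sum peval_mult)

lemma lin_D: "f \<in> carrier (pring X) \<Longrightarrow> lin (D f) = D f"
  by (simp add: D_eq_sum lin_sum \<rho>_def if_distrib[of lin] cong: if_cong)

text \<open>The linear part of the Groebner basis element \<open>pvar z - h z\<close>.\<close>

definition u :: "nat \<Rightarrow> 'k mpol"
  where "u z = pvar z - lin (h z)"

lemma h_X: "z \<in> set zs \<Longrightarrow> h z \<in> carrier (pring X)"
  using h_Y by simp

lemma u_Lin: "z \<in> set zs \<Longrightarrow> u z \<in> Lin X I"
  using lin_mem_Lin[OF h_I, of z X] by (simp add: u_def h_X)

lemma lookup_h: "z \<in> set zs \<Longrightarrow> z' \<in> set zs \<Longrightarrow> lookup (h z) (tvar z') = 0"
  using h_Y[of z] by (auto simp: carrier_pring_iff Y_def in_keys_iff dest!: subsetD[of _ _ "tvar z'"])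

lemma lookup_u: "z \<in> set zs \<Longrightarrow> z' \<in> set zs \<Longrightarrow> lookup (u z) (tvar z') = (if z' = z then 1 else 0)"
  by (simp add: u_def lookup_minus lookup_pvar lookup_h)

lemma LT_u: "z \<in> set zs \<Longrightarrow> LT \<sigma> (u z) = tvar z"
proof (rule LT_eqI)
  assume z: "z \<in> set zs"
  then show "tvar z \<in> keys (u z)"
    by (simp add: in_keys_iff lookup_u)
  fix k assume "k \<in> keys (u z)"
  then have "k = tvar z \<or> k \<in> keys (h z)"
    using keys_diff[of "pvar z" "lin (h z)"] keys_lin[of "h z"] by (auto simp: u_def)
  then show "(k, tvar z) \<in> \<sigma>"
    using z zs_X h_ord ord_refl[of "tvar z"] by auto
qed

text \<open>The coefficients of the forms \<open>u z\<close> at the indeterminates in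
  \<open>set zs\<close> form an identity matrix, so the forms are independent; being as many as the
  dimension, they span.\<close>

lemma Span_u: "ring.Span (pring X) (range pconst) (map u zs) = Lin X I"
proof -
  interpret ring "pring X :: 'k mpol ring" by (rule pring_ring)
  have carr: "set (map u zs') \<subseteq> carrier (pring X)" if "set zs' \<subseteq> set zs" for zs'
    using that by (auto simp: u_def h_X)
  have "independent (range pconst) (map u zs')" if "set zs' \<subseteq> set zs" "distinct zs'" for zs'
    using that
  proof (induction zs')
    case (Cons z zs')
    \<comment> \<open>The coefficient at \<open>z\<close> separates \<open>u z\<close> from the span
      of the others.\<close>
    have "Span (range pconst) (map u zs') \<subseteq> {v. lookup v (tvar z) = 0}"
      using Cons.prems by (intro Span_subsetI) (auto simp: lookup_u lookup_add)
    moreover have "lookup (u z) (tvar z) \<noteq> 0"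
      using Cons.prems by (simp add: lookup_u)
    ultimately have "u z \<notin> Span (range pconst) (map u zs')" by blast
    then show ?case
      using Cons carr[of "[z]"] by (auto intro: li_Cons)
  qed simp
  then have "independent (range pconst) (map u zs)"
    using distinct_zs by simp
  from independent_length_eq_dimension[OF pconst_subfield dim this]
  show ?thesis
    using u_Lin by auto
qed

lemma peval_\<rho>_Lin: "v \<in> Lin X I \<Longrightarrow> peval \<rho> v = 0"
proof -
  interpret ring "pring X :: 'k mpol ring" by (rule pring_ring)
  have "peval \<rho> (u z) = 0" if z: "z \<in> set zs" for z
    using z h_Y by (simp add: u_def peval_diff \<rho>_simps peval_\<rho>_Y)
  then have "Span (range pconst) (map u zs) \<subseteq> {v. peval \<rho> v = 0}"
    by (intro Span_subsetI) (auto simp: peval_add peval_mult)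
  then show "v \<in> Lin X I \<Longrightarrow> peval \<rho> v = 0"
    unfolding Span_u by blast
qed

lemma D_I: "f \<in> I \<Longrightarrow> D f = 0"
  unfolding D_def by (intro peval_\<rho>_Lin lin_mem_Lin pideal_closed(1)[OF ideal_I])

lemma Lin_X: "Lin X I \<subseteq> carrier (pring X)"
proof -
  interpret ring "pring X :: 'k mpol ring" by (rule pring_ring)
  show ?thesis
    unfolding Span_u[symmetric]
    by (rule Span_in_carrier) (auto simp: u_def h_X)
qed

lemma LT_ideal_Lin:
  "Idl\<^bsub>pring X\<^esub> (pvar ` set zs) = LT_ideal X \<sigma> (Idl\<^bsub>pring X\<^esub> (Lin X I))"
proof -
  interpret ring "pring X :: 'k mpol ring" by (rule pring_ring)
  let ?U = "Idl\<^bsub>pring X\<^esub> (Lin X I)"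
  have U: "ideal ?U (pring X)"
    by (rule genideal_ideal[OF Lin_X])
  \<comment> \<open>The kernel is an ideal, so vanishing on \<open>Lin X I\<close> extends to all of
    \<open>?U\<close>, whose leading terms are in question.\<close>
  let ?K = "{f \<in> carrier (pring X). peval \<rho> f = 0}"
  have "ideal ?K (pring X)"
    by (rule pidealI) (auto simp: peval_add peval_mult)
  then have U_K: "?U \<subseteq> ?K"
    using Lin_X peval_\<rho>_Lin by (intro genideal_minimal) auto
  have L: "lead_terms \<sigma> ?U \<subseteq> pterms X"
    using U_K by (intro lead_terms_subset) auto
  have sub: "pmonom ` lead_terms \<sigma> ?U \<subseteq> carrier (pring X :: 'k mpol ring)"
    using L by auto
  have sub': "pvar ` set zs \<subseteq> carrier (pring X :: 'k mpol ring)"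
    by auto
  show ?thesis
    unfolding LT_ideal_eq
  proof
    have "tvar z \<in> lead_terms \<sigma> ?U" if z: "z \<in> set zs" for z
    proof -
      have "u z \<in> ?U - {0}"
        using u_Lin[OF z] genideal_self[OF Lin_X] lookup_u[OF z z] by auto
      then show ?thesis
        unfolding lead_terms_def using LT_u[OF z] by (metis imageI)
    qed
    then have "pvar ` set zs \<subseteq> (pmonom ` lead_terms \<sigma> ?U :: 'k mpol set)"
      by (auto simp: pvar_def)
    then show "Idl\<^bsub>pring X\<^esub> (pvar ` set zs) \<subseteq> (Idl\<^bsub>pring X\<^esub> (pmonom ` lead_terms \<sigma> ?U) :: 'k mpol set)"
      using genideal_self[OF sub] by (intro genideal_minimal genideal_ideal[OF sub]) blast
    have "(pmonom t :: 'k mpol) \<in> Idl\<^bsub>pring X\<^esub> (pvar ` set zs)" if "t \<in> lead_terms \<sigma> ?U" for t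
    proof -
      obtain f where t: "t = LT \<sigma> f" and "f \<in> ?U - {0}"
        using \<open>t \<in> lead_terms \<sigma> ?U\<close> unfolding lead_terms_def by (rule imageE)
      with U_K have f: "f \<in> carrier (pring X)" "f \<noteq> 0" "peval \<rho> f = 0"
        by auto
      have tX: "t \<in> pterms X"
        unfolding t using f by (intro LT_mem_pterms)
      have "t \<notin> pterms Y"
      proof
        assume "t \<in> pterms Y"
        then have "term_eval \<rho> t = pmonom t"
          using peval_\<rho>_Y[of "pmonom t"] by simp
        \<comment> \<open>For \<open>i\<close> in \<open>set zs\<close> this is the normal form
          bound \<open>h_ord\<close>, inherited by the linear part.\<close>
        moreover have "k \<in> pterms X \<and> (k, tvar i) \<in> \<sigma>" if i: "i \<in> X" and k: "k \<in> keys (\<rho> i)" for i k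
        proof
          show "k \<in> pterms X"
            using \<rho>_Y[OF i] k Y_pring[of "\<rho> i"] by (auto simp: carrier_pring_iff)
          show "(k, tvar i) \<in> \<sigma>"
            using i k keys_lin[of "h i"] h_ord[of i k] by (auto simp: \<rho>_def ord_refl split: if_splits)
        qed
        ultimately show False
          using peval_nonzero[of \<rho> f] f t by blast
      qed
      with tX show ?thesis
        using zs_X by (auto simp: Idl_pvar pterms_def Y_def)
    qed
    then show "(Idl\<^bsub>pring X\<^esub> (pmonom ` lead_terms \<sigma> ?U) :: 'k mpol set) \<subseteq> Idl\<^bsub>pring X\<^esub> (pvar ` set zs)"
      using genideal_ideal[OF sub'] by (intro genideal_minimal) auto
  qed
qed

lemma S_set_eq: "S_set X \<sigma> I = set zs"
  unfolding S_set_def LT_ideal_Lin[symmetric]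
proof (rule the_equality)
  show "minimal_indet_generators X (Idl\<^bsub>pring X\<^esub> (pvar ` set zs) :: 'k mpol set) (set zs)"
    unfolding minimal_indet_generators_def
    using zs_X Idl_pvar_inj[of _ X "set zs"] by blast
next
  fix S assume "minimal_indet_generators X (Idl\<^bsub>pring X\<^esub> (pvar ` set zs) :: 'k mpol set) S"
  then show "S = set zs"
    unfolding minimal_indet_generators_def using zs_X Idl_pvar_inj[of S X "set zs"] by blast
qed

text \<open>The independent forms \<open>pvar y\<close> lie in the span of the values of
  \<open>D\<close> at lifts of the indeterminates in \<open>W\<close>. \<open>D\<close> may be
  applied to lifts because it vanishes on \<open>I\<close>.\<close>

lemma card_Y_le:
  assumes "re_embedding X I W J' \<Psi>"
  shows "card Y \<le> card W"
proof -
  \<comment> \<open>Scalars are taken from the coefficient type, so that the exchange bound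
    \<open>independent_span_bound\<close> applies.\<close>
  interpret vs: vector_space "\<lambda>c p. pconst c * p :: 'k mpol"
    by unfold_locales (simp_all add: algebra_simps pconst_add pconst_mult)
  have W: "finite W" and J': "ideal J' (pring W)" and \<Psi>: "\<Psi> \<in> alg_iso X I W J'"
    using assms by (auto simp: re_embedding_def)
  have hom: "\<Psi> \<in> ring_hom (pring X Quot I) (pring W Quot J')"
    and \<Psi>_const: "\<And>c. \<Psi> (I +>\<^bsub>pring X\<^esub> pconst c) = J' +>\<^bsub>pring W\<^esub> pconst c"
    and bij: "bij_betw \<Psi> (carrier (pring X Quot I)) (carrier (pring W Quot J'))"
    using \<Psi> by (auto simp: alg_iso_def alg_hom_def ring_iso_def)
  have "\<exists>f\<in>carrier (pring X). \<Psi> (I +>\<^bsub>pring X\<^esub> f) = J' +>\<^bsub>pring W\<^esub> pvar w" if "w \<in> W" for w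
  proof -
    have "J' +>\<^bsub>pring W\<^esub> pvar w \<in> \<Psi> ` carrier (pring X Quot I)"
      using bij that by (simp add: bij_betw_def pquot_carrier)
    then show ?thesis by (auto simp: carrier_Quot)
  qed
  then obtain g where g: "\<And>w. w \<in> W \<Longrightarrow> g w \<in> carrier (pring X)"
      "\<And>w. w \<in> W \<Longrightarrow> \<Psi> (I +>\<^bsub>pring X\<^esub> g w) = J' +>\<^bsub>pring W\<^esub> pvar w"
    by metis
  let ?B = "(\<lambda>w. D (g w)) ` W"
  \<comment> \<open>The condition on \<open>D f\<close> survives products, as \<open>D_mult\<close>
    writes \<open>D (f * f')\<close> as a combination of \<open>D f\<close> and \<open>D f'\<close>,
    whatever the constant terms are.\<close>
  have lift: "\<exists>f\<in>carrier (pring X). \<Psi> (I +>\<^bsub>pring X\<^esub> f) = J' +>\<^bsub>pring W\<^esub> q \<and> D f \<in> vs.span ?B"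
    if "q \<in> carrier (pring W)" for q
    using that
  proof (induction rule: pring_induct)
    case (pconst c)
    show ?case
      by (intro bexI[of _ "pconst c"]) (simp_all add: \<Psi>_const vs.span_zero)
  next
    case (pvar w)
    then show ?case
      by (intro bexI[of _ "g w"]) (auto simp: g intro: vs.span_base)
  next
    case (add p q)
    then obtain f f' where ff': "f \<in> carrier (pring X)" "f' \<in> carrier (pring X)"
        "\<Psi> (I +>\<^bsub>pring X\<^esub> f) = J' +>\<^bsub>pring W\<^esub> p" "\<Psi> (I +>\<^bsub>pring X\<^esub> f') = J' +>\<^bsub>pring W\<^esub> q"
        "D f \<in> vs.span ?B" "D f' \<in> vs.span ?B"
      by blast
    then have "\<Psi> (I +>\<^bsub>pring X\<^esub> (f + f')) = J' +>\<^bsub>pring W\<^esub> (p + q)"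
      using add.hyps
      by (simp add: pquot_simps(1)[OF ideal_I, symmetric] pquot_simps(1)[OF J', symmetric]
          ring_hom_add[OF hom] pquot_carrier)
    then show ?case
      using ff' by (intro bexI[of _ "f + f'"]) (auto intro: vs.span_add)
  next
    case (mult p q)
    then obtain f f' where ff': "f \<in> carrier (pring X)" "f' \<in> carrier (pring X)"
        "\<Psi> (I +>\<^bsub>pring X\<^esub> f) = J' +>\<^bsub>pring W\<^esub> p" "\<Psi> (I +>\<^bsub>pring X\<^esub> f') = J' +>\<^bsub>pring W\<^esub> q"
        "D f \<in> vs.span ?B" "D f' \<in> vs.span ?B"
      by blast
    then have "\<Psi> (I +>\<^bsub>pring X\<^esub> (f * f')) = J' +>\<^bsub>pring W\<^esub> (p * q)"
      using mult.hyps
      by (simp add: pquot_simps(2)[OF ideal_I, symmetric] pquot_simps(2)[OF J', symmetric]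
          ring_hom_mult[OF hom] pquot_carrier)
    then show ?case
      using ff' by (intro bexI[of _ "f * f'"]) (auto simp: D_mult intro!: vs.span_add vs.span_scale)
  qed
  have "pvar y \<in> vs.span ?B" if y: "y \<in> Y" for y
  proof -
    have yX: "(pvar y :: 'k mpol) \<in> carrier (pring X)" using y by simp
    have "\<Psi> (I +>\<^bsub>pring X\<^esub> pvar y) \<in> carrier (pring W Quot J')"
      using ring_hom_closed[OF hom pquot_carrier[OF yX]] .
    then obtain q where q: "q \<in> carrier (pring W)" "\<Psi> (I +>\<^bsub>pring X\<^esub> pvar y) = J' +>\<^bsub>pring W\<^esub> q"
      by (auto simp: carrier_Quot)
    obtain f where f: "f \<in> carrier (pring X)" "\<Psi> (I +>\<^bsub>pring X\<^esub> f) = J' +>\<^bsub>pring W\<^esub> q"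
        "D f \<in> vs.span ?B"
      using lift[OF q(1)] by blast
    \<comment> \<open>Injectivity identifies the lift \<open>f\<close> with \<open>pvar y\<close>
      modulo \<open>I\<close>, whence \<open>pvar y = D (pvar y) = D f\<close>.\<close>
    have "I +>\<^bsub>pring X\<^esub> pvar y = I +>\<^bsub>pring X\<^esub> f"
      using bij_betw_imp_inj_on[OF bij] q(2) f(1,2) yX by (metis inj_onD pquot_carrier)
    then have "pvar y - f \<in> I"
      using yX f(1) by (simp add: pideal_coset_eq_iff[OF ideal_I])
    then have "D (pvar y - f) = 0" by (rule D_I)
    with f(3) y show ?thesis by simp
  qed
  then have "pvar ` Y \<subseteq> vs.span ?B" by blast
  moreover have "vs.independent (pvar ` Y)"
  proof (rule vs.independent_if_scalars_zero)
    fix c and v :: "'k mpol"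
    assume sum: "(\<Sum>v\<in>pvar ` Y. pconst (c v) * v :: 'k mpol) = 0" and "v \<in> pvar ` Y"
    then obtain y where y: "y \<in> Y" "v = pvar y" by blast
    have inj: "inj_on (pvar :: nat \<Rightarrow> 'k mpol) Y"
      by (rule inj_onI) (metis keys_pvar singleton_inject tvar_inj)
    have "0 = lookup (\<Sum>i\<in>Y. pconst (c (pvar i)) * pvar i) (tvar y)"
      using sum by (simp add: sum.reindex[OF inj])
    also have "\<dots> = c v"
      using y finite_Y by (simp add: lookup_sum lookup_pvar if_distrib[of "(*) _"] cong: if_cong)
    finally show "c v = 0" by simp
  qed (use finite_Y in simp)
  ultimately have "card (pvar ` Y :: 'k mpol set) \<le> card ?B"
    using W by (intro vs.independent_span_bound[THEN conjunct2]) auto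
  also have "\<dots> \<le> card W"
    using W by (rule card_image_le)
  also have "card (pvar ` Y :: 'k mpol set) = card Y"
    by (rule card_image) (metis inj_onI keys_pvar singleton_inject tvar_inj)
  finally show ?thesis .
qed

lemma optimal: "optimal_re_embedding X I Y J restr"
  unfolding optimal_re_embedding_def
proof (intro conjI allI impI)
  fix W J' \<Psi> assume "re_embedding X I W J' \<Psi>"
  then show "krull_dim (pring Y :: 'k mpol ring) \<le> krull_dim (pring W :: 'k mpol ring)"
    using finite_Y card_Y_le by (intro krull_dim_pring_mono) (auto simp: re_embedding_def)
qed (rule restr_re_embedding)

section \<open>The cotangent space of the residue class ring\<close>

lemma ring_PI: "ring (pring X Quot I)"
  by (rule ideal.quotient_is_ring[OF ideal_I])

lemma ideal_max_image_sq: "ideal (max_image_sq X I) (pring X Quot I)"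
proof -
  have "ideal (max_image X I) (pring X Quot I)"
    unfolding max_image_def
    by (rule ring.ring_ideal_imp_quot_ideal[OF pring_ring ideal_I ideal_origin_ideal])
  then show ?thesis
    unfolding max_image_sq_def by (intro ring.ideal_prod_is_ideal[OF ring_PI])
qed

lemma ring_cot: "ring (cot_ring X I)"
  unfolding cot_ring_def by (rule ideal.quotient_is_ring[OF ideal_max_image_sq])

lemma cot_hom: "cot_class X I \<in> ring_hom (pring X) (cot_ring X I)"
  using ring_hom_trans[OF ideal.rcos_ring_hom[OF ideal_I] ideal.rcos_ring_hom[OF ideal_max_image_sq]]
  by (simp add: cot_ring_def cot_class_def[abs_def] comp_def)

lemma cot_simps:
  assumes "f \<in> carrier (pring X)" "g \<in> carrier (pring X)"
  shows "cot_class X I f \<oplus>\<^bsub>cot_ring X I\<^esub> cot_class X I g = cot_class X I (f + g)"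
    and "cot_class X I f \<otimes>\<^bsub>cot_ring X I\<^esub> cot_class X I g = cot_class X I (f * g)"
  using ring_hom_add[OF cot_hom assms] ring_hom_mult[OF cot_hom assms] by simp_all

lemma cot_eq_zero:
  assumes "I +>\<^bsub>pring X\<^esub> e \<in> max_image_sq X I"
  shows "cot_class X I e = \<zero>\<^bsub>cot_ring X I\<^esub>"
  using ring.a_rcos_zero[OF ring_PI ideal_max_image_sq assms]
  by (simp add: cot_class_def cot_ring_def FactRing_def)

lemma cot_zero: "cot_class X I 0 = \<zero>\<^bsub>cot_ring X I\<^esub>"
  using ring_hom_zero[OF cot_hom pring_ring ring_cot] by simp

lemma cot_I:
  assumes "f \<in> carrier (pring X)" "g \<in> carrier (pring X)" "f - g \<in> I"
  shows "cot_class X I f = cot_class X I g"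
proof -
  have "I +>\<^bsub>pring X\<^esub> f = I +>\<^bsub>pring X\<^esub> g"
    using assms by (simp add: pideal_coset_eq_iff[OF ideal_I])
  then show ?thesis by (simp add: cot_class_def)
qed

text \<open>By the product rule, \<open>D\<close> kills a product of two polynomials without
  constant term, and such products generate the square additively.\<close>

lemma max_image_sq_D:
  assumes "C \<in> max_image_sq X I"
  obtains e where "e \<in> carrier (pring X)" "C = I +>\<^bsub>pring X\<^esub> e" "D e = 0"
proof -
  have "\<exists>e\<in>carrier (pring X). C = I +>\<^bsub>pring X\<^esub> e \<and> D e = 0"
    using assms unfolding max_image_sq_def
  proof (induction rule: ideal_prod.induct)
    case (prod A B)
    then obtain f g where "f \<in> origin_ideal X" "g \<in> origin_ideal X"
        "A = I +>\<^bsub>pring X\<^esub> f" "B = I +>\<^bsub>pring X\<^esub> g"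
      by (auto simp: max_image_def)
    then show ?case
      by (intro bexI[of _ "f * g"]) (simp_all add: origin_ideal_iff D_mult pquot_simps[OF ideal_I])
  next
    case (sum A B)
    then obtain f g where "f \<in> carrier (pring X)" "g \<in> carrier (pring X)"
        "A = I +>\<^bsub>pring X\<^esub> f" "B = I +>\<^bsub>pring X\<^esub> g" "D f = 0" "D g = 0"
      by blast
    then show ?case
      by (intro bexI[of _ "f + g"]) (simp_all add: pquot_simps[OF ideal_I])
  qed
  with that show thesis by blast
qed

text \<open>\<open>D\<close> descends to the cotangent space: it vanishes on \<open>I\<close> and on
  representatives of the square. This detects independence of the classes of
  \<open>Y\<close>.\<close>

lemma cot_eq_imp_D_eq:
  assumes "f \<in> carrier (pring X)" "g \<in> carrier (pring X)" "cot_class X I f = cot_class X I g"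
  shows "D f = D g"
proof -
  interpret Q: ring "pring X Quot I" by (rule ring_PI)
  let ?A = "I +>\<^bsub>pring X\<^esub> f" and ?B = "I +>\<^bsub>pring X\<^esub> g"
  \<comment> \<open>A coset contains its representative, written as a sum with zero to match the
    definition of a coset.\<close>
  have "\<zero>\<^bsub>pring X Quot I\<^esub> \<oplus>\<^bsub>pring X Quot I\<^esub> ?A \<in> cot_class X I f"
    unfolding cot_class_def a_r_coset_def'
    using additive_subgroup.zero_closed[OF ideal.axioms(1)[OF ideal_max_image_sq]] by blast
  then have "?A \<in> cot_class X I g"
    using assms(3) Q.l_zero[OF pquot_carrier[OF assms(1)]] by simp
  then obtain C where "C \<in> max_image_sq X I" "?A = C \<oplus>\<^bsub>pring X Quot I\<^esub> ?B"
    unfolding cot_class_def a_r_coset_def'[of "pring X Quot I"] by blast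
  then obtain e where e: "e \<in> carrier (pring X)" "D e = 0" "?A = I +>\<^bsub>pring X\<^esub> (e + g)"
    using max_image_sq_D[of C] assms(2) pquot_simps(1)[OF ideal_I] by metis
  then have "f - (e + g) \<in> I"
    using assms by (simp add: pideal_coset_eq_iff[OF ideal_I])
  then have "D (f - (e + g)) = 0" by (rule D_I)
  with e(2) show ?thesis by simp
qed

text \<open>A monomial of degree at least 2 is a product of two polynomials without constant term,
  so its class vanishes.\<close>

lemma cot_lin:
  assumes "f \<in> carrier (pring X)"
  shows "cot_class X I f = cot_class X I (pconst (lookup f 0) + lin f)"
  using assms
proof (induction rule: pring_linear_induct)
  case (pmonom c t)
  let ?m = "pconst c * pmonom t :: 'k mpol"
  consider "t = 0" | i where "t = tvar i" | i u j v where "t = tvar i + u" "u = tvar j + v"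
      "i \<in> X" "j \<in> X" "v \<in> pterms X"
  proof (cases "t = 0")
    case False
    obtain i u where iu: "i \<in> X" "u \<in> pterms X" "t = tvar i + u"
      using pterm_cases[OF pmonom False] by blast
    show thesis
    proof (cases "u = 0")
      case False
      obtain j v where "j \<in> X" "v \<in> pterms X" "u = tvar j + v"
        using pterm_cases[OF iu(2) False] by blast
      with iu show thesis by (intro that(3))
    qed (use iu that(2) in simp)
  qed (use that in simp)
  then show ?case
  proof cases
    case 1
    then show ?thesis by (simp add: lookup_pconst)
  next
    case (2 i)
    then show ?thesis by (simp add: lookup_pvar flip: pvar_def)
  next
    case (3 i u j v)
    \<comment> \<open>One indeterminate is split off as \<open>?b\<close>; \<open>?a\<close> takes
      the rest and still contains \<open>pvar j\<close>.\<close>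
    let ?a = "pconst c * pmonom v * pvar j :: 'k mpol" and ?b = "pvar i :: 'k mpol"
    have m: "?m = ?a * ?b"
      by (simp add: 3 pmonom_add pvar_def mult_ac)
    have deg: "term_degree t > 1"
      by (simp add: 3 term_degree_add)
    have ab: "?a \<in> origin_ideal X" "?b \<in> origin_ideal X"
      using 3 by (simp_all add: origin_ideal_iff lookup_zero_mult lookup_pvar)
    then have "I +>\<^bsub>pring X\<^esub> ?m \<in> max_image_sq X I"
      unfolding m max_image_sq_def max_image_def
      by (auto simp: origin_ideal_iff pquot_simps(2)[OF ideal_I, symmetric] intro!: ideal_prod.prod)
    then have "cot_class X I ?m = cot_class X I 0"
      by (simp add: cot_eq_zero cot_zero)
    moreover have "pconst (lookup ?m 0) + lin ?m = 0"
    proof (rule poly_mapping_eqI)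
      fix s
      show "lookup (pconst (lookup ?m 0) + lin ?m) s = lookup 0 s"
        using deg by (cases "s = t") (auto simp: lookup_add lookup_pconst lookup_lin lookup_pmonom)
    qed
    ultimately show ?thesis by simp
  qed
next
  case (add f g)
  let ?n = "\<lambda>f. pconst (lookup f 0) + lin f"
  have "cot_class X I (f + g) = cot_class X I (?n f) \<oplus>\<^bsub>cot_ring X I\<^esub> cot_class X I (?n g)"
    unfolding add.IH[symmetric] using add.hyps by (rule cot_simps(1)[symmetric])
  also have "\<dots> = cot_class X I (?n f + ?n g)"
    using add.hyps by (intro cot_simps(1)) simp_all
  also have "?n f + ?n g = ?n (f + g)"
    by (simp add: lookup_add pconst_add)
  finally show ?case .
qed

lemma cot_sum_cong:
  assumes "\<And>i. i \<in> A \<Longrightarrow> a i \<in> carrier (pring X)" "\<And>i. i \<in> A \<Longrightarrow> b i \<in> carrier (pring X)"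
    and "\<And>i. i \<in> A \<Longrightarrow> cot_class X I (a i) = cot_class X I (b i)"
  shows "cot_class X I (\<Sum>i\<in>A. a i) = cot_class X I (\<Sum>i\<in>A. b i)"
  using assms
  by (induction A rule: infinite_finite_induct)
    (auto simp: cot_simps(1)[symmetric] pring_sum_closed)

text \<open>Modulo \<open>I\<close>, \<open>z\<close> equals \<open>h z\<close>, which has no
  constant term because \<open>pvar z - h z\<close> and \<open>pvar z\<close> have none; modulo the
  square only its linear part remains.\<close>

lemma cot_\<rho>:
  assumes "i \<in> X"
  shows "cot_class X I (pvar i) = cot_class X I (\<rho> i)"
proof (cases "i \<in> set zs")
  case True
  have "lookup (h i) 0 = 0"
    using lookup_I_zero[OF h_I[OF True]] by (simp add: lookup_minus lookup_pvar)
  then show ?thesis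
    using cot_I[OF _ _ h_I[OF True]] cot_lin[of "h i"] True assms h_X
    by (simp add: \<rho>_simps)
qed (simp add: \<rho>_def)

text \<open>Each class in the cotangent space is thus represented by a linear form in K[Y], which
  gives generation by the classes of \<open>Y\<close>.\<close>

lemma cot_D:
  assumes "f \<in> carrier (pring X)" "lookup f 0 = 0"
  shows "cot_class X I f = cot_class X I (D f)"
proof -
  have "cot_class X I f = cot_class X I (\<Sum>i\<in>X. pconst (lookup f (tvar i)) * pvar i)"
    using cot_lin[OF assms(1)] assms(2) linear_form_X[OF assms(1)] by simp
  also have "\<dots> = cot_class X I (D f)"
    unfolding D_eq_sum[OF assms(1)]
    by (intro cot_sum_cong) (simp_all add: \<rho>_Y cot_\<rho> cot_simps(2)[symmetric])
  finally show ?thesis .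
qed

lemma cotangent_basis:
  "vs_basis (cot_ring X I) (cot_scalars X I) (cotangent_space X I)
    (map (\<lambda>i. cot_class X I (pvar i)) (sorted_list_of_set Y))"
proof -
  interpret R: ring "cot_ring X I" by (rule ring_cot)
  let ?K = "cot_scalars X I" and ?us = "map (\<lambda>i. cot_class X I (pvar i))"
  have indep: "R.independent ?K (?us ys)" if "distinct ys" "set ys \<subseteq> Y" for ys
    using that
  proof (induction ys)
    case (Cons y ys)
    \<comment> \<open>The coefficient of \<open>D f\<close> at \<open>y\<close> depends only on the
      class of \<open>f\<close>; it vanishes on the span of the other classes and is 1 at
      \<open>pvar y\<close>.\<close>
    let ?F = "{f \<in> carrier (pring X). lookup (D f) (tvar y) = 0}"
    have "R.Span ?K (?us ys) \<subseteq> cot_class X I ` ?F"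
    proof (rule R.Span_subsetI)
      show "set (?us ys) \<subseteq> cot_class X I ` ?F"
        using Cons.prems by (auto simp: lookup_pvar intro!: imageI)
      show "\<zero>\<^bsub>cot_ring X I\<^esub> \<in> cot_class X I ` ?F"
        unfolding cot_zero[symmetric] by (rule imageI) (simp add: D_def)
    qed (auto simp: cot_scalars_def cot_simps lookup_add intro!: imageI)
    moreover have "cot_class X I (pvar y) \<notin> cot_class X I ` ?F"
    proof
      assume "cot_class X I (pvar y) \<in> cot_class X I ` ?F"
      then obtain f where f: "f \<in> ?F" "cot_class X I (pvar y) = cot_class X I f" by blast
      then have "pvar y = D f"
        using cot_eq_imp_D_eq[of "pvar y" f] Cons.prems by simp
      moreover have "lookup (pvar y :: 'k mpol) (tvar y) = 1"
        by (simp add: lookup_pvar)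
      ultimately show False using f(1) by simp
    qed
    moreover have "cot_class X I (pvar y) \<in> carrier (cot_ring X I)"
      using Cons.prems by (intro ring_hom_closed[OF cot_hom]) simp
    moreover have "R.independent ?K (?us ys)"
      using Cons by simp
    ultimately show ?case
      unfolding list.map by (blast intro: R.li_Cons)
  qed simp
  have span: "cot_class X I (\<Sum>y\<in>set ys. pconst (c y) * pvar y) \<in> R.Span ?K (?us ys)"
    if "distinct ys" "set ys \<subseteq> Y" for ys c
    using that
  proof (induction ys)
    case Nil
    then show ?case by (simp add: cot_zero)
  next
    case (Cons y ys)
    let ?s = "\<Sum>y\<in>set ys. pconst (c y) * pvar y"
    have "cot_class X I (\<Sum>y\<in>set (y # ys). pconst (c y) * pvar y) =
        cot_class X I (pconst (c y)) \<otimes>\<^bsub>cot_ring X I\<^esub> cot_class X I (pvar y)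
          \<oplus>\<^bsub>cot_ring X I\<^esub> cot_class X I ?s"
      using Cons.prems by (simp add: cot_simps pring_sum_closed subset_iff)
    moreover have "cot_class X I ?s \<in> R.Span ?K (?us ys)"
      using Cons by simp
    ultimately show ?case
      by (auto simp: R.line_extension_mem_iff cot_scalars_def)
  qed
  have E: "cotangent_space X I = cot_class X I ` origin_ideal X"
    by (simp add: cotangent_space_def max_image_def cot_class_def image_image)
  have "R.Span ?K (?us (sorted_list_of_set Y)) = cotangent_space X I"
    unfolding E
  proof
    show "R.Span ?K (?us (sorted_list_of_set Y)) \<subseteq> cot_class X I ` origin_ideal X"
    proof (rule R.Span_subsetI)
      show "set (?us (sorted_list_of_set Y)) \<subseteq> cot_class X I ` origin_ideal X"
        using finite_Y Y_X by (auto simp: origin_ideal_iff lookup_pvar intro!: imageI)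
      show "\<zero>\<^bsub>cot_ring X I\<^esub> \<in> cot_class X I ` origin_ideal X"
        unfolding cot_zero[symmetric] by (rule imageI) (simp add: origin_ideal_iff)
    qed (auto simp: cot_scalars_def cot_simps origin_ideal_iff lookup_add intro!: imageI)
    show "cot_class X I ` origin_ideal X \<subseteq> R.Span ?K (?us (sorted_list_of_set Y))"
    proof
      fix C assume "C \<in> cot_class X I ` origin_ideal X"
      then obtain f where f: "f \<in> carrier (pring X)" "lookup f 0 = 0" "C = cot_class X I f"
        by (auto simp: origin_ideal_iff)
      have "D f = (\<Sum>y\<in>Y. pconst (lookup (D f) (tvar y)) * pvar y)"
        using finite_Y D_Y[OF f(1)] lin_D[OF f(1)] by (rule linear_form_eq)
      then have "C = cot_class X I (\<Sum>y\<in>Y. pconst (lookup (D f) (tvar y)) * pvar y)"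
        using cot_D[OF f(1,2)] f(3) by simp
      then show "C \<in> R.Span ?K (?us (sorted_list_of_set Y))"
        using span[of "sorted_list_of_set Y" "\<lambda>y. lookup (D f) (tvar y)"] finite_Y by simp
    qed
  qed
  moreover have "R.independent ?K (?us (sorted_list_of_set Y))"
    using finite_Y by (intro indep) simp_all
  ultimately show ?thesis by (simp add: vs_basis_def)
qed

end

theorem corollary2p8:
  fixes n :: nat
    and I :: "'k::field mpol set"
    and zs :: "nat list"
    and \<sigma> :: "pterm rel"
    and X Y :: "nat set"
  assumes "X = {1..n}"
    and "ideal I (pring X)"
    and "I \<subseteq> origin_ideal X"
    and "distinct zs" and "set zs \<subseteq> X" and "1 \<le> length zs" and "length zs \<le> n"
    and "Y = X - set zs"
    and "separating X zs I"
    and "separating_ordering X zs I \<sigma>"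
    and "ring.dimension (pring X) (length zs) (range pconst) (Lin X I)"
  shows "optimal_re_embedding X I Y (I \<inter> carrier (pring Y)) (separating_re_embedding X zs \<sigma> I)
    \<and> (Idl\<^bsub>pring X\<^esub> (pvar ` set zs) = LT_ideal X \<sigma> (Idl\<^bsub>pring X\<^esub> (Lin X I))
        \<and> Y = X - S_set X \<sigma> I)
    \<and> vs_basis (cot_ring X I) (cot_scalars X I) (cotangent_space X I)
        (map (\<lambda>i. cot_class X I (pvar i)) (sorted_list_of_set Y))"
proof -
  interpret sep: separated_ideal X I zs \<sigma>
    by (rule separated_ideal.intro[OF _ assms(2-5,10)]) (simp add: assms(1))
  obtain h G' where "coordinate_forms X I zs \<sigma> h G'"
    by (rule sep.ex_coordinate_forms)
  then interpret full_linear_part X I zs \<sigma> h G'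
    by (rule full_linear_part.intro) (rule full_linear_part_axioms.intro[OF assms(11)])
  have Y: "Y = sep.Y" and J: "I \<inter> carrier (pring Y) = sep.J"
    by (simp_all add: assms(8) sep.Y_def sep.J_def)
  show ?thesis
    \<comment> \<open>\<open>J\<close> has to be rewritten first, since its left-hand side mentions
      \<open>Y\<close>.\<close>
    unfolding J unfolding Y separating_re_embedding_eq S_set_eq
    using optimal LT_ideal_Lin cotangent_basis sep.Y_def by blast
qed

end
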